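(* Let $f$ be a real-valued additive arithmetical function such that the series $$\sum_{p} \frac{\min(1, f(p)^2)}{p}, \qquad \sum_{\substack{p \\ |f(p)| \leq 1}} \frac{f(p)}{p}$$ converge and $\sum_{f(p)\neq0} 1/p = \infty$. Let $\eta_f$, $\varepsilon_x$, $B_f$, $F$, $Q_F$, $F_x$ be as in the context, and let $C_0>0$. Then there is a constant $C$ depending only on $C_0$ (uniform in $f$) such that for all $R\ge3$, $T\ge3$, $x\ge3$ satisfying $$2\log_2 R + \tfrac12 T^2\eta_f(R) + 7 \le \tfrac14\log(1/\varepsilon_x), \qquad T^2\eta_f(x^{\varepsilon_x}) \le C_0\,\varepsilon_x^{1/3},$$ we have $$\sup_{y\in\mathbb{R}}|F_x(y)-F(y)| \le C\left( Q_F\Big(\frac1T\Big) + \varepsilon_x^{1/6}\log\Big(\frac{T B_f(R)}{\varepsilon_x}\Big) + \eta_f(R)\right).$$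
   Context: $p$ denotes primes, $\log_2=\log\log$. $f$ additive means $f(mn)=f(m)+f(n)$ for coprime $m,n$. $\eta_f:[1,\infty)\to[0,\infty)$ is any continuous non-increasing function tending to $0$ at infinity such that for all $y\ge1$ $$\Big|\sum_{\substack{p>y\\|f(p)|\le1}} \frac{f(p)}{p}\Big| \le \eta_f(y), \qquad \sum_{p^\nu>y}\frac{\min(1,f(p^\nu)^2)}{p^\nu}\le \eta_f(y)$$ (the last sum over prime powers $p^\nu$, $\nu\ge1$). For $x\ge2$, $\varepsilon_x$ is a quantity with $1/\sqrt{\log x}<\varepsilon_x$, $\varepsilon_x\to0$ as $x\to\infty$, and $\eta_f(x^{\varepsilon_x}) = o(\varepsilon_x^{1/3})$ as $x\to\infty$. $B_f(v)^2 := 2+\sum_{p^\nu\le v} f(p^\nu)^2/p^\nu$. $F$ is the limiting distribution function of $f$, i.e. the distribution function with characteristic function $\int e^{i\tau y}dF(y) = \prod_p (1-1/p)\sum_{\nu\ge0} e^{i\tau f(p^\nu)}/p^\nu$. $Q_F(\ell) := \sup_{y\in\mathbb{R}}\{F(y+\ell)-F(y)\}$ is its concentration function. $F_x(y) := \frac1x\#\{n\le x: f(n)\le y\}$. *)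

theory Defs
  imports "HOL-Probability.Probability" "HOL-Number_Theory.Number_Theory"
    "HOL-Library.Landau_Symbols"
begin

text \<open>
  Series and products over primes or prime powers are indexed by the natural numbers, with the
  neutral element at the remaining indices, so they are taken in increasing order of the prime
  (power). This matters since \<open>\<Sum> f(p)/p\<close> and the product defining the limit law
  may converge only conditionally.
\<close>

definition additive_function :: "(nat \<Rightarrow> real) \<Rightarrow> bool" where
  "additive_function f \<longleftrightarrow>
     (\<forall>m n. m > 0 \<longrightarrow> n > 0 \<longrightarrow> coprime m n \<longrightarrow> f (m * n) = f m + f n)"

definition tail_majorant :: "(nat \<Rightarrow> real) \<Rightarrow> (real \<Rightarrow> real) \<Rightarrow> bool" where
  "tail_majorant f \<eta> \<longleftrightarrow>
     continuous_on {1..} \<eta> \<and> antimono_on {1..} \<eta> \<and> (\<forall>y\<ge>1. \<eta> y \<ge> 0) \<and> (\<eta> \<longlongrightarrow> 0) at_top \<and>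
     (\<forall>y\<ge>1. \<bar>\<Sum>p. if prime p \<and> real p > y \<and> \<bar>f p\<bar> \<le> 1 then f p / real p else 0\<bar> \<le> \<eta> y) \<and>
     (\<forall>y\<ge>1. (\<Sum>q. if primepow q \<and> real q > y then min 1 ((f q)\<^sup>2) / real q else 0) \<le> \<eta> y)"

definition admissible_eps :: "(real \<Rightarrow> real) \<Rightarrow> (real \<Rightarrow> real) \<Rightarrow> bool" where
  "admissible_eps \<eta> \<epsilon> \<longleftrightarrow>
     (\<forall>x\<ge>2. 1 / sqrt (ln x) < \<epsilon> x) \<and> (\<epsilon> \<longlongrightarrow> 0) at_top \<and>
     (\<lambda>x. \<eta> (x powr \<epsilon> x)) \<in> o[at_top](\<lambda>x. \<epsilon> x powr (1/3))"

definition B_fun :: "(nat \<Rightarrow> real) \<Rightarrow> real \<Rightarrow> real" where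
  "B_fun f v = sqrt (2 + (\<Sum>q | primepow q \<and> real q \<le> v. (f q)\<^sup>2 / real q))"

definition limit_law :: "(nat \<Rightarrow> real) \<Rightarrow> real measure \<Rightarrow> bool" where
  "limit_law f M \<longleftrightarrow> real_distribution M \<and>
     (\<forall>\<tau>. (\<lambda>p. if prime p
               then of_real (1 - 1 / real p) * (\<Sum>\<nu>. cis (\<tau> * f (p ^ \<nu>)) / of_nat (p ^ \<nu>))
               else 1) has_prod char M \<tau>)"

definition concentration :: "(real \<Rightarrow> real) \<Rightarrow> real \<Rightarrow> real" where
  "concentration F l = (SUP y. F (y + l) - F y)"

definition empirical_cdf :: "(nat \<Rightarrow> real) \<Rightarrow> real \<Rightarrow> real \<Rightarrow> real" where
  "empirical_cdf f x y = real (card {n::nat. 1 \<le> n \<and> real n \<le> x \<and> f n \<le> y}) / x"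

end

theory Submission
  imports Defs
begin

text \<open>
  Put \<open>y = x powr \<epsilon> x\<close> and split \<open>f\<close> into the contributions of the primes up to \<open>y\<close> and beyond
  \<open>y\<close>. By Selberg's sieve, the exponents of the small primes in a random integer up to \<open>x\<close> are within
  total variation distance \<open>O(\<epsilon> x)\<close> of independent geometric variables; since total masses agree, the
  upper bound sieve alone suffices for this. The contribution of the large primes exceeds \<open>1 / T\<close> with
  probability \<open>O(T\<^sup>2 \<eta> y + 1 / y)\<close>, both among the integers and in the independent model, by a second
  moment estimate. Hence the two distribution functions differ by at most
  \<open>3 Q(1 / T) + O(\<epsilon> x powr (1/3))\<close>, with no Fourier inversion; \<open>R\<close> only serves to make \<open>\<epsilon> x\<close> small.
\<close>

subsection \<open>Selberg sieve\<close>

text \<open>The sieve loses an amount linear in \<open>\<epsilon> x\<close>: both the lower bound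
  for Selberg's sum and the truncation of the smooth part rest on Markov's inequality for a
  logarithm. This is affordable, since the large primes already cost
  \<open>\<epsilon> x powr (1/3)\<close>, which \<open>\<epsilon> x powr (1/6)\<close> absorbs
  because \<open>\<epsilon> x < 1\<close> and the logarithm in the claim is at least 1. Terms
  \<open>1 / y\<close> are harmless: \<open>\<epsilon> x > 1 / sqrt (ln x)\<close> forces
  \<open>y > 1 / \<epsilon> x\<close>. Two obstacles shape the rest. Counting multiples of p * q up
  to N makes a rounding error for every pair of primes, and these add up too much once the primes
  exceed the square root of N; there one uses instead that two such primes never divide the same
  integer. Moreover the product over primes may converge only conditionally and F is accessible only
  through its characteristic function, so F is reached as a weak limit of finite models, with tail
  bounds independent of the cutoff. Discarding large primes on both sides moves the threshold by up
  to \<open>2 / T\<close>, reaching a continuity point of F by less than another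
  \<open>1 / T\<close>: hence the factor 3.\<close>

lemma prod_primes_dvd_iff:
  fixes S :: "nat set"
  assumes "finite S" "\<And>p. p \<in> S \<Longrightarrow> prime p"
  shows "\<Prod>S dvd n \<longleftrightarrow> (\<forall>p\<in>S. p dvd n)"
  using assms
proof (induction S rule: finite_induct)
  case (insert p S)
  have "coprime p (\<Prod>S)"
    by (intro prod_coprime_right primes_coprime) (use insert in auto)
  then show ?case
    using insert by (auto intro!: divides_mult elim: dvd_mult_left dvd_mult_right)
qed auto

lemma card_multiples:
  assumes "d > 0"
  shows "card {n\<in>{1..N}. d dvd n} = N div (d::nat)"
proof -
  have "{n\<in>{1..N}. d dvd n} = (\<lambda>k. d * k) ` {1..N div d}"
  proof (intro equalityI subsetI)
    fix n assume "n \<in> {n\<in>{1..N}. d dvd n}"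
    then obtain k where k: "n = d * k" "1 \<le> n" "n \<le> N" by (auto elim: dvdE)
    then have "k \<le> N div d" using assms by (simp add: less_eq_div_iff_mult_less_eq mult.commute)
    with k show "n \<in> (\<lambda>k. d * k) ` {1..N div d}"
      by (cases "k = 0") auto
  next
    fix n assume "n \<in> (\<lambda>k. d * k) ` {1..N div d}"
    then show "n \<in> {n\<in>{1..N}. d dvd n}"
      using assms by (auto simp: less_eq_div_iff_mult_less_eq mult.commute)
  qed
  moreover have "inj_on (\<lambda>k. d * k) {1..N div d}"
    using assms by (auto simp: inj_on_def)
  ultimately show ?thesis by (simp add: card_image)
qed

lemma sum_of_bool_dvd:
  assumes "d > 0"
  shows "(\<Sum>n=1..N. of_bool (d dvd n) :: real) = real (N div d)"
proof -
  have "(\<Sum>n=1..N. of_bool (d dvd n) :: real) = real (card ({1..N} \<inter> {n. d dvd n}))"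
    by (simp add: sum_of_bool_eq)
  also have "{1..N} \<inter> {n. d dvd n} = {n\<in>{1..N}. d dvd n}" by auto
  finally show ?thesis using card_multiples[OF assms] by simp
qed

lemma abs_real_div_diff_le: "\<bar>real (N div d) - real N / real d\<bar> \<le> 1"
proof -
  have "real (N div d) = of_int \<lfloor>real N / real d\<rfloor>"
    by (simp add: floor_divide_of_nat_eq)
  then show ?thesis by linarith
qed

text \<open>Expanding the product over subsets X of S leaves one divisibility condition by
  \<open>\<Prod>X\<close> for each X. Every such count is off by at most 1, and the coefficients
  \<open>\<bar>prod a X\<bar>\<close> sum to the product on the right.\<close>

lemma sum_local_prod_approx:
  fixes a :: "nat \<Rightarrow> real"
  assumes S: "finite S" "\<And>p. p \<in> S \<Longrightarrow> prime p"
  shows "\<bar>(\<Sum>n=1..N. \<Prod>p\<in>S. 1 + a p * of_bool (p dvd n)) - real N * (\<Prod>p\<in>S. 1 + a p / real p)\<bar>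
          \<le> (\<Prod>p\<in>S. 1 + \<bar>a p\<bar>)"
proof -
  have *: "(\<Prod>p\<in>S. 1 + a p * of_bool (p dvd n)) = (\<Sum>X\<in>Pow S. prod a X * of_bool (\<Prod>X dvd n))" for n
  proof -
    have "(\<Prod>p\<in>S. 1 + a p * of_bool (p dvd n)) = (\<Prod>p\<in>S. a p * of_bool (p dvd n) + 1)"
      by (simp add: add.commute)
    also have "\<dots> = (\<Sum>X\<in>Pow S. \<Prod>p\<in>X. a p * of_bool (p dvd n))"
      by (subst prod_add) (use S in auto)
    also have "\<dots> = (\<Sum>X\<in>Pow S. prod a X * of_bool (\<Prod>X dvd n))"
    proof (rule sum.cong)
      fix X assume "X \<in> Pow S"
      then have fX: "finite X" "\<And>p. p \<in> X \<Longrightarrow> prime p"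
        using S finite_subset by auto
      show "(\<Prod>p\<in>X. a p * of_bool (p dvd n)) = prod a X * of_bool (\<Prod>X dvd n)"
        using prod_primes_dvd_iff[OF fX, of n] fX(1)
        by (auto simp: prod.distrib)
    qed auto
    finally show ?thesis .
  qed
  have main: "(\<Prod>p\<in>S. 1 + a p / real p) = (\<Sum>X\<in>Pow S. prod a X / real (\<Prod>X))"
  proof -
    have "(\<Prod>p\<in>S. 1 + a p / real p) = (\<Prod>p\<in>S. a p / real p + 1)"
      by (simp add: add.commute)
    then show ?thesis
      using S by (simp add: prod_add prod_dividef)
  qed
  have err: "(\<Prod>p\<in>S. 1 + \<bar>a p\<bar>) = (\<Sum>X\<in>Pow S. \<bar>prod a X\<bar>)"
  proof -
    have "(\<Prod>p\<in>S. 1 + \<bar>a p\<bar>) = (\<Prod>p\<in>S. \<bar>a p\<bar> + 1)"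
      by (simp add: add.commute)
    then show ?thesis
      using S by (simp add: prod_add abs_prod)
  qed
  have "(\<Sum>n=1..N. \<Prod>p\<in>S. 1 + a p * of_bool (p dvd n))
      = (\<Sum>X\<in>Pow S. prod a X * (\<Sum>n=1..N. of_bool (\<Prod>X dvd n)))"
    unfolding * sum_distrib_left by (rule sum.swap)
  also have "\<dots> = (\<Sum>X\<in>Pow S. prod a X * real (N div \<Prod>X))"
  proof (rule sum.cong)
    fix X assume "X \<in> Pow S"
    then have "\<Prod>X > 0" using S by (intro prod_pos) (auto simp: prime_gt_0_nat)
    then show "prod a X * (\<Sum>n=1..N. of_bool (\<Prod>X dvd n)) = prod a X * real (N div \<Prod>X)"
      by (simp only: sum_of_bool_dvd)
  qed auto
  finally have "(\<Sum>n=1..N. \<Prod>p\<in>S. 1 + a p * of_bool (p dvd n)) - real N * (\<Prod>p\<in>S. 1 + a p / real p)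
     = (\<Sum>X\<in>Pow S. prod a X * (real (N div \<Prod>X) - real N / real (\<Prod>X)))"
    unfolding main sum_distrib_left
    by (simp only: sum_subtractf[symmetric]) (intro sum.cong, auto simp: field_simps)
  also have "\<bar>\<dots>\<bar> \<le> (\<Sum>X\<in>Pow S. \<bar>prod a X * (real (N div \<Prod>X) - real N / real (\<Prod>X))\<bar>)"
    by (rule sum_abs)
  also have "\<dots> \<le> (\<Sum>X\<in>Pow S. \<bar>prod a X\<bar>)"
  proof (rule sum_mono)
    fix X
    have "\<bar>prod a X\<bar> * \<bar>real (N div \<Prod>X) - real N / real (\<Prod>X)\<bar> \<le> \<bar>prod a X\<bar> * 1"
      by (intro mult_left_mono abs_real_div_diff_le) auto
    then show "\<bar>prod a X * (real (N div \<Prod>X) - real N / real (\<Prod>X))\<bar> \<le> \<bar>prod a X\<bar>"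
      by (simp only: abs_mult mult_1_right)
  qed
  finally show ?thesis by (simp add: err)
qed

text \<open>A set S of primes stands for the squarefree number \<open>d = \<Prod>S\<close>, and the
  weight is 1 / phi(d) with Euler's phi. Thus \<open>sieve_level\<close> is Selberg's sum of 1 /
  phi(d) over squarefree d up to D composed of primes from P.\<close>

definition sieve_weight :: "nat set \<Rightarrow> real" where
  "sieve_weight S = (\<Prod>p\<in>S. 1 / (real p - 1))"

definition sieve_level :: "nat set \<Rightarrow> real \<Rightarrow> real" where
  "sieve_level P D = (\<Sum>S | S \<subseteq> P \<and> real (\<Prod>S) \<le> D. sieve_weight S)"

lemma sieve_weight_nonneg: "(\<And>p. p \<in> S \<Longrightarrow> prime p) \<Longrightarrow> sieve_weight S \<ge> 0"
  unfolding sieve_weight_def by (intro prod_nonneg) (use prime_ge_1_nat in force)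

text \<open>
  Selberg's sieve in its dual form: the functions \<open>\<Prod>p\<in>S. 1 - p [p | n]\<close> are orthogonal with
  respect to the mean value in \<open>n\<close>, and any combination of them with coefficients
  \<open>sieve_weight S\<close> takes the constant value \<open>sieve_level\<close> on integers free of primes from \<open>P\<close>.
\<close>
lemma selberg_sieve:
  assumes P: "finite P" "\<And>p. p \<in> P \<Longrightarrow> prime p" and D: "D \<ge> 1"
  shows "real (card {n\<in>{1..N}. \<forall>p\<in>P. \<not> p dvd n}) \<le> real N / sieve_level P D + D ^ 4"
proof -
  define F where "F = {S. S \<subseteq> P \<and> real (\<Prod>S) \<le> D}"
  define L where "L = sieve_level P D"
  define \<psi> where "\<psi> S n = (\<Prod>p\<in>S. 1 - real p * of_bool (p dvd n))" for S and n :: nat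
  define h where "h n = (\<Sum>S\<in>F. sieve_weight S * \<psi> S n)" for n
  have finF: "finite F" unfolding F_def by (rule finite_subset[of _ "Pow P"]) (use P in auto)
  have L: "L = sum sieve_weight F" by (simp add: L_def sieve_level_def F_def)
  have nonneg: "sieve_weight S \<ge> 0" if "S \<in> F" for S
    using that P by (intro sieve_weight_nonneg) (auto simp: F_def)
  have "sieve_weight {} \<le> L"
    unfolding L by (rule member_le_sum) (use finF nonneg D in \<open>auto simp: F_def\<close>)
  then have L1: "L \<ge> 1" by (simp add: sieve_weight_def)
  have corr: "(\<Sum>n=1..N. \<psi> S n * \<psi> S' n)
      \<le> real N * (if S = S' then 1 / sieve_weight S else 0) + D ^ 4"
    if SS: "S \<in> F" "S' \<in> F" for S S'
  proof -
    \<comment> \<open>For p in both sets the square of \<open>1 - real p * of_bool (p dvd n)\<close>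
      is expanded, otherwise the factor occurs once. The mean \<open>1 + e p / real p\<close> is p -
      1 in the first case and 0 in the second, which is the orthogonality.\<close>
    define e where "e p = (if p \<in> S \<inter> S' then real p ^ 2 - 2 * real p else - real p)" for p
    have fin: "finite S" "finite S'" using SS P finite_subset unfolding F_def by auto
    have pr: "\<And>p. p \<in> S \<union> S' \<Longrightarrow> prime p" using SS P unfolding F_def by auto
    have "\<psi> S n * \<psi> S' n = (\<Prod>p\<in>S \<union> S'. 1 + e p * of_bool (p dvd n))" for n
    proof -
      have "\<psi> S n = (\<Prod>p\<in>S \<union> S'. if p \<in> S then 1 - real p * of_bool (p dvd n) else 1)"
        unfolding \<psi>_def using fin by (intro prod.mono_neutral_cong_left) auto
      moreover have "\<psi> S' n = (\<Prod>p\<in>S \<union> S'. if p \<in> S' then 1 - real p * of_bool (p dvd n) else 1)"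
        unfolding \<psi>_def using fin by (intro prod.mono_neutral_cong_left) auto
      ultimately show ?thesis
        unfolding e_def
        by (auto simp flip: prod.distrib intro!: prod.cong simp: algebra_simps power2_eq_square)
    qed
    then have "(\<Sum>n=1..N. \<psi> S n * \<psi> S' n) \<le> real N * (\<Prod>p\<in>S \<union> S'. 1 + e p / real p) + (\<Prod>p\<in>S \<union> S'. 1 + \<bar>e p\<bar>)"
      using sum_local_prod_approx[of "S \<union> S'" e N] fin pr by (auto simp: abs_le_iff)
    also have "(\<Prod>p\<in>S \<union> S'. 1 + e p / real p) = (if S = S' then 1 / sieve_weight S else 0)"
    proof (cases "S = S'")
      case True
      have "(\<Prod>p\<in>S. 1 + e p / real p) = (\<Prod>p\<in>S. real p - 1)"
      proof (rule prod.cong)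
        fix p assume "p \<in> S"
        moreover then have "p > 0" using pr prime_gt_0_nat by blast
        ultimately show "1 + e p / real p = real p - 1"
          using True by (simp add: e_def field_simps power2_eq_square)
      qed auto
      then show ?thesis
        using True by (simp add: sieve_weight_def prod_dividef)
    next
      case False
      then obtain p where p: "p \<in> S \<union> S'" "p \<notin> S \<inter> S'" by auto
      then have "1 + e p / real p = 0" using prime_gt_0_nat[OF pr[of p]] by (auto simp: e_def)
      then show ?thesis using False p fin by (auto simp: prod_zero_iff)
    qed
    also have "(\<Prod>p\<in>S \<union> S'. 1 + \<bar>e p\<bar>) \<le> (\<Prod>p\<in>S \<union> S'. real p ^ 2)"
    proof (intro prod_mono conjI)
      fix p assume "p \<in> S \<union> S'"
      then have "real p \<ge> 2" using prime_ge_2_nat[OF pr] by (metis of_nat_le_iff of_nat_numeral)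
      then have "real p * (real p - 2) \<ge> 0" "(real p - 2) * (real p + 1) \<ge> 0" by auto
      then show "1 + \<bar>e p\<bar> \<le> real p ^ 2" using \<open>real p \<ge> 2\<close>
        by (auto simp: e_def power2_eq_square algebra_simps)
    qed auto
    \<comment> \<open>Factors at least 1 are inserted so that union and intersection regroup into S
      and S', each of which has product at most D.\<close>
    also have "(\<Prod>p\<in>S \<union> S'. real p ^ 2) \<le> (\<Prod>p\<in>S \<union> S'. real p ^ 2) * (\<Prod>p\<in>S \<inter> S'. real p ^ 2)"
    proof -
      have "(\<Prod>p\<in>S \<inter> S'. real p ^ 2) \<ge> 1"
        by (rule prod_ge_1) (use pr prime_ge_1_nat in auto)
      then have "(\<Prod>p\<in>S \<union> S'. real p ^ 2) * 1 \<le> (\<Prod>p\<in>S \<union> S'. real p ^ 2) * (\<Prod>p\<in>S \<inter> S'. real p ^ 2)"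
        by (intro mult_left_mono prod_nonneg) auto
      then show ?thesis by simp
    qed
    also have "\<dots> = (\<Prod>p\<in>S. real p ^ 2) * (\<Prod>p\<in>S'. real p ^ 2)"
      by (rule prod.union_inter) (use fin in auto)
    also have "\<dots> = real (\<Prod>S) ^ 2 * real (\<Prod>S') ^ 2"
      by (simp add: prod_power_distrib)
    also have "\<dots> \<le> D ^ 2 * D ^ 2"
      using SS by (intro mult_mono power_mono) (auto simp: F_def prod_nonneg simp flip: of_nat_prod)
    finally show ?thesis by (simp flip: power_add)
  qed
  have "real (card {n\<in>{1..N}. \<forall>p\<in>P. \<not> p dvd n}) * L\<^sup>2 = (\<Sum>n\<in>{n\<in>{1..N}. \<forall>p\<in>P. \<not> p dvd n}. L\<^sup>2)"
    by simp
  also have "\<dots> = (\<Sum>n\<in>{n\<in>{1..N}. \<forall>p\<in>P. \<not> p dvd n}. (h n)\<^sup>2)"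
  proof (rule sum.cong)
    fix n assume "n \<in> {n\<in>{1..N}. \<forall>p\<in>P. \<not> p dvd n}"
    then have "\<psi> S n = 1" if "S \<in> F" for S
      unfolding \<psi>_def using that by (intro prod.neutral) (auto simp: F_def)
    then show "L\<^sup>2 = (h n)\<^sup>2" by (simp add: h_def L)
  qed auto
  also have "\<dots> \<le> (\<Sum>n=1..N. (h n)\<^sup>2)"
    by (rule sum_mono2) auto
  also have "\<dots> = (\<Sum>S\<in>F. \<Sum>S'\<in>F. sieve_weight S * sieve_weight S' * (\<Sum>n=1..N. \<psi> S n * \<psi> S' n))"
  proof -
    have "(\<Sum>n=1..N. (h n)\<^sup>2)
        = (\<Sum>n=1..N. \<Sum>S\<in>F. \<Sum>S'\<in>F. sieve_weight S * sieve_weight S' * (\<psi> S n * \<psi> S' n))"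
      by (simp add: h_def power2_eq_square sum_product algebra_simps)
    also have "\<dots> = (\<Sum>S\<in>F. \<Sum>n=1..N. \<Sum>S'\<in>F. sieve_weight S * sieve_weight S' * (\<psi> S n * \<psi> S' n))"
      by (rule sum.swap)
    also have "\<dots> = (\<Sum>S\<in>F. \<Sum>S'\<in>F. \<Sum>n=1..N. sieve_weight S * sieve_weight S' * (\<psi> S n * \<psi> S' n))"
      by (intro sum.cong refl sum.swap)
    finally show ?thesis by (simp add: sum_distrib_left)
  qed
  also have "\<dots> \<le> (\<Sum>S\<in>F. \<Sum>S'\<in>F. sieve_weight S * sieve_weight S' *
      (real N * (if S = S' then 1 / sieve_weight S else 0) + D ^ 4))"
    by (intro sum_mono mult_left_mono corr mult_nonneg_nonneg nonneg)
  \<comment> \<open>On the diagonal the squared coefficient meets the mean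
    \<open>1 / sieve_weight S\<close>, so a single weight survives and the diagonal sums to N * L.
    Dividing by the square of L will leave N / L.\<close>
  also have "\<dots> = (\<Sum>S\<in>F. \<Sum>S'\<in>F. (if S = S' then real N * sieve_weight S' else 0))
                 + (\<Sum>S\<in>F. \<Sum>S'\<in>F. sieve_weight S * sieve_weight S' * D ^ 4)"
    unfolding sum.distrib[symmetric] by (intro sum.cong) (auto simp: algebra_simps)
  also have "(\<Sum>S\<in>F. \<Sum>S'\<in>F. (if S = S' then real N * sieve_weight S' else 0)) = real N * L"
    by (simp add: L sum_distrib_left finF)
  also have "(\<Sum>S\<in>F. \<Sum>S'\<in>F. sieve_weight S * sieve_weight S' * D ^ 4) = L\<^sup>2 * D ^ 4"
    by (simp only: L power2_eq_square sum_product) (simp only: sum_distrib_right)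
  also have "real N * L + L\<^sup>2 * D ^ 4 = (real N / L + D ^ 4) * L\<^sup>2"
    using L1 by (simp add: field_simps power2_eq_square)
  finally have "real (card {n\<in>{1..N}. \<forall>p\<in>P. \<not> p dvd n}) * L\<^sup>2 \<le> (real N / L + D ^ 4) * L\<^sup>2" .
  then show ?thesis using L1 by (simp add: L_def)
qed

section \<open>Lower bound for Selberg's sum\<close>

lemma ln_prod_primes:
  assumes "finite S" "\<And>p. p \<in> S \<Longrightarrow> prime (p::nat)"
  shows "ln (real (\<Prod>S)) = (\<Sum>p\<in>S. ln (real p))"
  using assms by (simp add: ln_prod prime_gt_0_nat)

text \<open>A double count of a Mertens type sum: the logarithms of the distinct primes dividing m
  add up to at most \<open>ln m\<close>, and summing over m up to n counts each p exactly
  \<open>n div p\<close> times. As p is at most n, this quotient is at least half of n / p, which is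
  the origin of the factor 2.\<close>

lemma sum_ln_prime_over_prime_le:
  assumes "n \<ge> 1"
  shows "(\<Sum>p | prime p \<and> p \<le> n. ln (real p) / real p) \<le> 2 * ln (real n)"
proof -
  let ?P = "{p. prime p \<and> p \<le> n}"
  have fin: "finite ?P" by (rule finite_subset[of _ "{..n}"]) auto
  have "(\<Sum>p\<in>?P. ln (real p) * (real n / (2 * real p))) \<le> (\<Sum>p\<in>?P. ln (real p) * real (n div p))"
  proof (intro sum_mono mult_left_mono)
    fix p assume p: "p \<in> ?P"
    then have p0: "p > 0" by (auto simp: prime_gt_0_nat)
    have "n div p \<ge> 1" using p p0 by (simp add: Suc_le_eq div_greater_zero_iff)
    moreover have "\<bar>real (n div p) - real n / real p\<bar> \<le> 1" by (rule abs_real_div_diff_le)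
    ultimately show "real n / (2 * real p) \<le> real (n div p)"
      by (simp add: field_simps abs_le_iff)
    show "0 \<le> ln (real p)" using p0 by simp
  qed
  also have "\<dots> = (\<Sum>p\<in>?P. \<Sum>m=1..n. ln (real p) * of_bool (p dvd m))"
    by (intro sum.cong refl, subst sum_distrib_left[symmetric], subst sum_of_bool_dvd)
       (auto simp: prime_gt_0_nat)
  also have "\<dots> = (\<Sum>m=1..n. \<Sum>p\<in>?P. ln (real p) * of_bool (p dvd m))"
    by (rule sum.swap)
  also have "\<dots> \<le> (\<Sum>m=1..n. ln (real n))"
  proof (rule sum_mono)
    fix m assume m: "m \<in> {1..n}"
    let ?S = "{p\<in>?P. p dvd m}"
    have "(\<Sum>p\<in>?P. ln (real p) * of_bool (p dvd m)) = (\<Sum>p\<in>?S. ln (real p))"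
      using fin by (intro sum.mono_neutral_cong_right) auto
    also have "\<dots> = ln (real (\<Prod>?S))"
      using fin by (intro ln_prod_primes[symmetric]) auto
    also have "\<dots> \<le> ln (real n)"
    proof -
      have "\<Prod>?S dvd m" using fin by (subst prod_primes_dvd_iff) auto
      then have "\<Prod>?S \<le> n" using m dvd_imp_le[of "\<Prod>?S" m] by auto
      moreover have "\<Prod>?S > 0" by (intro prod_pos) (auto simp: prime_gt_0_nat)
      ultimately have "real (\<Prod>?S) > 0" "real (\<Prod>?S) \<le> real n" by linarith+
      then show ?thesis by (subst ln_le_cancel_iff) auto
    qed
    finally show "(\<Sum>p\<in>?P. ln (real p) * of_bool (p dvd m)) \<le> ln (real n)" .
  qed
  also have "\<dots> = real n * ln (real n)" by simp
  also have "(\<Sum>p\<in>?P. ln (real p) * (real n / (2 * real p))) = real n / 2 * (\<Sum>p\<in>?P. ln (real p) / real p)"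
    by (simp add: sum_distrib_left field_simps)
  finally show ?thesis using assms by (simp add: field_simps)
qed

text \<open>Multiplied by the product over P, the weights become the law of a random subset S of P
  that contains each p independently with probability 1 / p. The expectation of
  \<open>ln (\<Prod>S)\<close> is then the sum of \<open>ln p / p\<close>, and Markov's inequality
  bounds the probability that \<open>\<Prod>S\<close> exceeds D.\<close>

lemma sieve_level_lower:
  assumes P: "finite P" "\<And>p. p \<in> P \<Longrightarrow> prime p" and D: "D > 1"
  shows "(\<Prod>p\<in>P. 1 - 1 / real p) * sieve_level P D \<ge> 1 - (\<Sum>p\<in>P. ln (real p) / real p) / ln D"
proof -
  define V where "V A = (\<Prod>p\<in>A. 1 - 1 / real p)" for A :: "nat set"
  have ge2: "real p \<ge> 2" if "p \<in> P" for p
    using P(2)[OF that] prime_ge_2_nat by (metis of_nat_le_iff of_nat_numeral)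
  have wn: "sieve_weight S \<ge> 0" if "S \<subseteq> P" for S
    using that P by (intro sieve_weight_nonneg) auto
  have V0: "V A \<ge> 0" if "A \<subseteq> P" for A
    unfolding V_def using that ge2 by (intro prod_nonneg) (force simp: field_simps)
  have total: "V A * (\<Sum>S\<in>Pow A. sieve_weight S) = 1" if A: "A \<subseteq> P" for A
  proof -
    have "(\<Sum>S\<in>Pow A. sieve_weight S) = (\<Prod>p\<in>A. 1 / (real p - 1) + 1)"
      unfolding sieve_weight_def using finite_subset[OF A P(1)] by (simp add: prod_add)
    then have "V A * (\<Sum>S\<in>Pow A. sieve_weight S) = (\<Prod>p\<in>A. (1 - 1 / real p) * (1 / (real p - 1) + 1))"
      unfolding V_def by (simp add: prod.distrib)
    also have "\<dots> = 1"
    proof (rule prod.neutral, rule ballI)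
      fix p assume "p \<in> A"
      then have "real p \<ge> 2" using A ge2 by blast
      then show "(1 - 1 / real p) * (1 / (real p - 1) + 1) = 1" by (simp add: field_simps)
    qed
    finally show ?thesis .
  qed
  \<comment> \<open>The marginal of the random subset: sets containing p correspond to subsets of
    the remaining primes, whose normalised weights sum to 1.\<close>
  have hit: "V P * (\<Sum>S\<in>Pow P. sieve_weight S * of_bool (p \<in> S)) = 1 / real p" if p: "p \<in> P" for p
  proof -
    have "(\<Sum>S\<in>Pow P. sieve_weight S * of_bool (p \<in> S)) = (\<Sum>S\<in>{S\<in>Pow P. p \<in> S}. sieve_weight S)"
      using P by (intro sum.mono_neutral_cong_right) auto
    also have "{S\<in>Pow P. p \<in> S} = insert p ` Pow (P - {p})"
      using p by (auto simp: image_iff intro!: bexI[where x = "x - {p}" for x])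
    also have "(\<Sum>S\<in>insert p ` Pow (P - {p}). sieve_weight S) = (\<Sum>S\<in>Pow (P - {p}). sieve_weight (insert p S))"
      by (rule sum.reindex_cong[of "insert p"]) (auto simp: inj_on_def)
    also have "\<dots> = (\<Sum>S\<in>Pow (P - {p}). 1 / (real p - 1) * sieve_weight S)"
    proof (rule sum.cong)
      fix S assume S: "S \<in> Pow (P - {p})"
      then have "finite S" "p \<notin> S" using finite_subset[of S P] P(1) by auto
      then show "sieve_weight (insert p S) = 1 / (real p - 1) * sieve_weight S"
        by (simp add: sieve_weight_def)
    qed auto
    finally have e: "(\<Sum>S\<in>Pow P. sieve_weight S * of_bool (p \<in> S)) = 1 / (real p - 1) * (\<Sum>S\<in>Pow (P - {p}). sieve_weight S)"
      by (simp add: sum_distrib_left)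
    have "V P = (1 - 1 / real p) * V (P - {p})"
      unfolding V_def using P p by (simp add: prod.remove)
    with e have "V P * (\<Sum>S\<in>Pow P. sieve_weight S * of_bool (p \<in> S))
      = (1 - 1 / real p) / (real p - 1) * (V (P - {p}) * (\<Sum>S\<in>Pow (P - {p}). sieve_weight S))"
      by simp
    also have "\<dots> = 1 / real p"
      using ge2[OF p] by (subst total) (auto simp: field_simps)
    finally show ?thesis .
  qed
  let ?F = "{S. S \<subseteq> P \<and> real (\<Prod>S) \<le> D}" and ?G = "{S. S \<subseteq> P \<and> \<not> real (\<Prod>S) \<le> D}"
  have split: "(\<Sum>S\<in>Pow P. sieve_weight S) = sieve_level P D + sum sieve_weight ?G"
  proof -
    have "Pow P = ?F \<union> ?G" by auto
    then show ?thesis unfolding sieve_level_def using P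
      by (subst sum.union_disjoint[symmetric]) (auto intro: finite_subset[of _ "Pow P"])
  qed
  have "ln D * sum sieve_weight ?G = (\<Sum>S\<in>?G. sieve_weight S * ln D)"
    by (simp add: sum_distrib_left mult.commute)
  also have "\<dots> \<le> (\<Sum>S\<in>?G. sieve_weight S * ln (real (\<Prod>S)))"
    using D by (intro sum_mono mult_left_mono wn) (auto simp del: of_nat_prod)
  also have "\<dots> \<le> (\<Sum>S\<in>Pow P. sieve_weight S * ln (real (\<Prod>S)))"
  proof (rule sum_mono2)
    fix S assume "S \<in> Pow P - ?G"
    then have S: "S \<subseteq> P" by auto
    have "\<Prod>S \<ge> 1" using S P prime_ge_1_nat by (intro prod_ge_1) auto
    then have "real (\<Prod>S) \<ge> 1" by linarith
    then show "0 \<le> sieve_weight S * ln (real (\<Prod>S))"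
      using wn[OF S] by (simp del: of_nat_prod)
  qed (use P in auto)
  also have "\<dots> = (\<Sum>S\<in>Pow P. \<Sum>p\<in>P. ln (real p) * (sieve_weight S * of_bool (p \<in> S)))"
  proof (rule sum.cong)
    fix S assume S: "S \<in> Pow P"
    have "ln (real (\<Prod>S)) = (\<Sum>p\<in>S. ln (real p))"
      using S P finite_subset by (intro ln_prod_primes) auto
    also have "\<dots> = (\<Sum>p\<in>P. ln (real p) * of_bool (p \<in> S))"
      using S P by (intro sum.mono_neutral_cong_left) auto
    finally show "sieve_weight S * ln (real (\<Prod>S)) = (\<Sum>p\<in>P. ln (real p) * (sieve_weight S * of_bool (p \<in> S)))"
      by (simp add: sum_distrib_left mult_ac)
  qed auto
  also have "\<dots> = (\<Sum>p\<in>P. ln (real p) * (\<Sum>S\<in>Pow P. sieve_weight S * of_bool (p \<in> S)))"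
    by (subst sum.swap) (simp add: sum_distrib_left)
  finally have "V P * (ln D * sum sieve_weight ?G) \<le> V P * \<dots>"
    by (rule mult_left_mono[OF _ V0]) auto
  also have "\<dots> = (\<Sum>p\<in>P. ln (real p) * (V P * (\<Sum>S\<in>Pow P. sieve_weight S * of_bool (p \<in> S))))"
    by (simp add: sum_distrib_left mult_ac)
  also have "\<dots> = (\<Sum>p\<in>P. ln (real p) / real p)"
    by (intro sum.cong) (auto simp: hit)
  finally have "V P * sum sieve_weight ?G \<le> (\<Sum>p\<in>P. ln (real p) / real p) / ln D"
    using D by (simp add: field_simps)
  moreover have "V P * sieve_level P D + V P * sum sieve_weight ?G = 1"
    using total[of P] split by (simp add: distrib_left)
  ultimately show ?thesis unfolding V_def by linarith
qed

subsection \<open>Exponent vectors of random integers\<close>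

text \<open>Cutting k off at N loses nothing, since 2 to the multiplicity is at most n. With a range
  independent of n, the sums over n and k can be exchanged.\<close>

lemma multiplicity_eq_sum:
  assumes "prime (p::nat)" "n \<in> {1..N}"
  shows "real (multiplicity p n) = (\<Sum>k=1..N. of_bool (p ^ k dvd n))"
proof -
  have "multiplicity p n \<le> N"
  proof -
    have "multiplicity p n < 2 ^ multiplicity p n" by (rule less_exp)
    also have "\<dots> \<le> p ^ multiplicity p n"
      using prime_ge_2_nat[OF assms(1)] by (rule power_mono) simp
    also have "\<dots> \<le> n" using assms multiplicity_dvd[of p n] by (intro dvd_imp_le) auto
    finally show ?thesis using assms(2) by simp
  qed
  moreover have "{1..N} \<inter> {k. p ^ k dvd n} = {1..N} \<inter> {..multiplicity p n}"
    using assms prime_ge_2_nat[OF assms(1)] by (auto simp: power_dvd_iff_le_multiplicity)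
  ultimately have "{1..N} \<inter> {k. p ^ k dvd n} = {1..multiplicity p n}" by auto
  then show ?thesis by (simp add: sum_of_bool_eq)
qed

lemma sum_power_le_geometric:
  fixes x :: real
  assumes "0 \<le> x" "x < 1"
  shows "(\<Sum>k=1..N. x ^ k) \<le> x / (1 - x)"
proof -
  have "(\<Sum>k=1..N. x ^ k) = (x - x ^ Suc N) / (1 - x)"
  proof (induction N)
    case (Suc N)
    have "(x - x ^ Suc N) / (1 - x) + x ^ Suc N = (x - x ^ Suc (Suc N)) / (1 - x)"
      using assms by (simp add: field_simps)
    with Suc show ?case by simp
  qed auto
  also have "\<dots> \<le> x / (1 - x)"
    using assms by (intro divide_right_mono) auto
  finally show ?thesis .
qed

lemma sum_multiplicity_le:
  assumes "prime (p::nat)"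
  shows "(\<Sum>n=1..N. real (multiplicity p n)) \<le> 2 * real N / real p"
proof -
  have p2: "real p \<ge> 2" using prime_ge_2_nat[OF assms] by linarith
  have "(\<Sum>n=1..N. real (multiplicity p n)) = (\<Sum>n=1..N. \<Sum>k=1..N. of_bool (p ^ k dvd n))"
    by (intro sum.cong refl multiplicity_eq_sum assms)
  also have "\<dots> = (\<Sum>k=1..N. \<Sum>n=1..N. of_bool (p ^ k dvd n))" by (rule sum.swap)
  also have "\<dots> = (\<Sum>k=1..N. real (N div p ^ k))"
    using p2 by (intro sum.cong refl sum_of_bool_dvd) auto
  also have "\<dots> \<le> (\<Sum>k=1..N. real N * (1 / real p) ^ k)"
  proof (rule sum_mono)
    fix k
    show "real (N div p ^ k) \<le> real N * (1 / real p) ^ k"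
      using of_nat_div_le_of_nat[of N "p ^ k", where ?'a = real]
      by (simp add: power_divide)
  qed
  also have "\<dots> = real N * (\<Sum>k=1..N. (1 / real p) ^ k)" by (simp add: sum_distrib_left)
  also have "\<dots> \<le> real N * ((1 / real p) / (1 - 1 / real p))"
    using p2 by (intro mult_left_mono sum_power_le_geometric) auto
  also have "\<dots> \<le> real N * (2 / real p)"
    using p2 by (intro mult_left_mono) (auto simp: field_simps)
  finally show ?thesis by (simp add: mult.commute)
qed

text \<open>The value 0 off P agrees with the default value of \<open>Pi_pmf\<close> in
  \<open>prime_model\<close>, so that both laws live on the same functions and can be compared on
  arbitrary sets of them. In that model, exponent k of p has mass
  \<open>(1 - 1 / p) / p ^ k\<close>, the density of the integers divisible by p exactly k
  times.\<close>

definition exponents :: "nat set \<Rightarrow> nat \<Rightarrow> nat \<Rightarrow> nat" where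
  "exponents P n = (\<lambda>p. if p \<in> P then multiplicity p n else 0)"

definition prime_model :: "nat set \<Rightarrow> (nat \<Rightarrow> nat) pmf" where
  "prime_model P = Pi_pmf P 0 (\<lambda>p. geometric_pmf (1 - 1 / real p))"

definition empirical_model :: "nat set \<Rightarrow> nat \<Rightarrow> (nat \<Rightarrow> nat) pmf" where
  "empirical_model P N = map_pmf (exponents P) (pmf_of_set {1..N})"

definition prime_product :: "nat set \<Rightarrow> (nat \<Rightarrow> nat) \<Rightarrow> nat" where
  "prime_product P v = (\<Prod>p\<in>P. p ^ v p)"

context
  fixes P :: "nat set"
  assumes finP: "finite P" and primeP: "\<And>p. p \<in> P \<Longrightarrow> prime p"
begin

lemma real_prime_ge_2: "p \<in> P \<Longrightarrow> real p \<ge> 2"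
  using prime_ge_2_nat[OF primeP] by (metis of_nat_le_iff of_nat_numeral)

lemma exponents_prime_product:
  "exponents P (prime_product P v) = (\<lambda>p. if p \<in> P then v p else 0)"
  unfolding exponents_def prime_product_def
  by (auto simp: fun_eq_iff multiplicity_prod_prime_powers finP primeP)

lemma prime_product_pos: "prime_product P v > 0"
  unfolding prime_product_def using primeP prime_gt_0_nat by (intro prod_pos) auto

lemma prime_product_dvd:
  assumes "n > 0"
  shows "prime_product P (exponents P n) dvd n"
proof (rule multiplicity_le_imp_dvd)
  fix p :: nat assume "prime p"
  then show "multiplicity p (prime_product P (exponents P n)) \<le> multiplicity p n"
    unfolding prime_product_def
    by (subst multiplicity_prod_prime_powers) (auto simp: finP primeP exponents_def)
qed (use assms prime_product_pos[of "exponents P n"] in auto)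

lemma pmf_prime_model:
  assumes "\<And>p. p \<notin> P \<Longrightarrow> v p = 0"
  shows "pmf (prime_model P) v = (\<Prod>p\<in>P. 1 - 1 / real p) / real (prime_product P v)"
proof -
  have "pmf (prime_model P) v = (\<Prod>p\<in>P. pmf (geometric_pmf (1 - 1 / real p)) (v p))"
    unfolding prime_model_def using finP assms by (rule pmf_Pi')
  also have "\<dots> = (\<Prod>p\<in>P. (1 - 1 / real p) / real (p ^ v p))"
  proof (rule prod.cong)
    fix p assume "p \<in> P"
    then have "real p \<ge> 2" by (rule real_prime_ge_2)
    then show "pmf (geometric_pmf (1 - 1 / real p)) (v p) = (1 - 1 / real p) / real (p ^ v p)"
      by (subst pmf_geometric) (auto simp: power_divide)
  qed auto
  finally show ?thesis by (simp add: prod_dividef prime_product_def)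
qed

text \<open>Let a be the number with exponent vector v. Every n in the fibre is a * m, and m is free
  of primes from P because a already carries their full multiplicity in n. So n determines m and
  conversely.\<close>

lemma card_fibre_le:
  assumes v: "\<And>p. p \<notin> P \<Longrightarrow> v p = 0"
  shows "card {n\<in>{1..N}. exponents P n = v}
    \<le> card {m\<in>{1..N div prime_product P v}. \<forall>p\<in>P. \<not> p dvd m}"
proof (rule card_inj_on_le[where f = "\<lambda>n. n div prime_product P v"])
  define a where "a = prime_product P v"
  have a0: "a > 0" unfolding a_def by (rule prime_product_pos)
  have dvd: "a dvd n" if "n \<in> {1..N}" "exponents P n = v" for n
    using prime_product_dvd[of n] that unfolding a_def by auto
  show "inj_on (\<lambda>n. n div prime_product P v) {n \<in> {1..N}. exponents P n = v}"
    using dvd by (auto simp: inj_on_def simp flip: a_def dest!: dvd_div_eq_cancel)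
  show "(\<lambda>n. n div prime_product P v) ` {n \<in> {1..N}. exponents P n = v}
      \<subseteq> {m \<in> {1..N div prime_product P v}. \<forall>p\<in>P. \<not> p dvd m}"
  proof safe
    fix n assume n: "n \<in> {1..N}" "v = exponents P n"
    then obtain m where m: "n = a * m" using dvd by blast
    have m0: "m > 0" using m n by (cases m) auto
    have nd: "n div prime_product P (exponents P n) = m"
      using m a0 n(2) unfolding a_def by (metis less_irrefl nonzero_mult_div_cancel_left)
    show "n div prime_product P (exponents P n) \<in> {1..N div prime_product P (exponents P n)}"
      using nd m0 n by (auto intro: div_le_mono)
    fix p assume p: "p \<in> P" and "p dvd n div prime_product P (exponents P n)"
    then have "p dvd m" using nd by simp
    have pp: "prime_elem p" using primeP[OF p] by simp
    have "multiplicity p a = multiplicity p n"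
      using p fun_cong[OF exponents_prime_product[of v], of p] n
      by (simp add: a_def exponents_def)
    moreover have "multiplicity p n = multiplicity p a + multiplicity p m"
      unfolding m using pp a0 m0 by (intro prime_elem_multiplicity_mult_distrib) auto
    moreover have "multiplicity p m > 0"
      using \<open>p dvd m\<close> m0 primeP[OF p] by (simp add: prime_multiplicity_gt_zero_iff)
    ultimately show False by simp
  qed
qed auto

text \<open>Markov's inequality for the logarithm of the part of n composed of primes from P. The
  factor 2 is inherited from the geometric series in \<open>sum_multiplicity_le\<close>.\<close>

lemma card_large_smooth_part:
  assumes B: "B > 1"
  shows "real (card {n\<in>{1..N}. real (prime_product P (exponents P n)) > B})
      \<le> real N * (2 * (\<Sum>p\<in>P. ln (real p) / real p) / ln B)"
proof -
  let ?S = "{n\<in>{1..N}. real (prime_product P (exponents P n)) > B}"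
  have pos: "ln (real (prime_product P (exponents P n))) = (\<Sum>p\<in>P. real (multiplicity p n) * ln (real p))" for n
  proof -
    have "ln (real (prime_product P (exponents P n))) = (\<Sum>p\<in>P. ln (real (p ^ exponents P n p)))"
      unfolding prime_product_def using finP primeP prime_gt_0_nat by (simp add: ln_prod)
    also have "\<dots> = (\<Sum>p\<in>P. real (multiplicity p n) * ln (real p))"
    proof (rule sum.cong)
      fix p assume "p \<in> P"
      then show "ln (real (p ^ exponents P n p)) = real (multiplicity p n) * ln (real p)"
        using real_prime_ge_2[of p] by (simp add: exponents_def ln_realpow)
    qed auto
    finally show ?thesis .
  qed
  have "real (card ?S) * ln B = (\<Sum>n\<in>?S. ln B)" by simp
  also have "\<dots> \<le> (\<Sum>n\<in>?S. ln (real (prime_product P (exponents P n))))"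
    using B by (intro sum_mono) auto
  also have "\<dots> \<le> (\<Sum>n=1..N. ln (real (prime_product P (exponents P n))))"
  proof (rule sum_mono2)
    fix n
    have "real (prime_product P (exponents P n)) \<ge> 1"
      using prime_product_pos[of "exponents P n"] by linarith
    then show "0 \<le> ln (real (prime_product P (exponents P n)))" by simp
  qed auto
  also have "\<dots> = (\<Sum>p\<in>P. ln (real p) * (\<Sum>n=1..N. real (multiplicity p n)))"
    unfolding pos by (subst sum.swap) (simp add: sum_distrib_left mult.commute)
  also have "\<dots> \<le> (\<Sum>p\<in>P. ln (real p) * (2 * real N / real p))"
  proof (intro sum_mono mult_left_mono sum_multiplicity_le primeP)
    fix p assume "p \<in> P"
    then show "0 \<le> ln (real p)" using real_prime_ge_2[of p] by simp
  qed
  also have "\<dots> = real N * (2 * (\<Sum>p\<in>P. ln (real p) / real p))"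
    by (simp add: sum_distrib_left mult_ac)
  finally show ?thesis using B by (simp add: field_simps)
qed

text \<open>The sieve is applied in each fibre, to the integers up to N divided by the smooth part
  a. Its remainder is the same for every fibre, so only the fibres with a at most B are sieved, of
  which there are at most B; the integers with a larger smooth part are counted directly.\<close>

lemma card_exponents_le_model:
  assumes D: "D > 1" and B: "B > 1" and \<delta>: "(\<Sum>p\<in>P. ln (real p) / real p) \<le> \<delta> * ln D" "\<delta> < 1"
  shows "real (card {n\<in>{1..N}. exponents P n \<in> A})
    \<le> real N * (measure_pmf.prob (prime_model P) A / (1 - \<delta>)) + B * D ^ 4
      + real N * (2 * (\<Sum>p\<in>P. ln (real p) / real p) / ln B)"
proof -
  define S where "S = {n\<in>{1..N}. exponents P n \<in> A \<and> real (prime_product P (exponents P n)) \<le> B}"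
  define W where "W = exponents P ` S"
  define V where "V = (\<Prod>p\<in>P. 1 - 1 / real p)"
  define L where "L = sieve_level P D"
  have VL: "1 - \<delta> \<le> V * L"
  proof -
    have "(\<Sum>p\<in>P. ln (real p) / real p) / ln D \<le> \<delta>"
      using D \<delta> by (simp add: field_simps)
    then show ?thesis
      using sieve_level_lower[OF finP primeP D] unfolding V_def L_def by linarith
  qed
  have V0: "V > 0" unfolding V_def
  proof (rule prod_pos)
    fix p assume "p \<in> P"
    then show "0 < 1 - 1 / real p" using real_prime_ge_2[of p] by simp
  qed
  have L0: "L > 0" using VL V0 \<delta> by (smt (verit) zero_less_mult_pos)
  \<comment> \<open>Since the model gives a vector v the mass V divided by its smooth part, this
    turns the sieve bound into the model mass up to the factor
    \<open>1 / (1 - \<delta>)\<close>.\<close>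
  have invL: "1 / L \<le> V / (1 - \<delta>)" using VL L0 \<delta> by (simp add: field_simps)
  have finS: "finite S" "finite W" unfolding W_def S_def by auto
  have W0: "v p = 0" if "v \<in> W" "p \<notin> P" for v p
    using that unfolding W_def by (auto simp: exponents_def)
  have fibre: "real (card {n\<in>{1..N}. exponents P n = v}) \<le> real N * (pmf (prime_model P) v / (1 - \<delta>)) + D ^ 4"
    if v: "v \<in> W" for v
  proof -
    let ?a = "prime_product P v"
    have "real (card {n\<in>{1..N}. exponents P n = v}) \<le> real (card {m\<in>{1..N div ?a}. \<forall>p\<in>P. \<not> p dvd m})"
      using card_fibre_le[of v N] W0[OF v] by simp
    also have "\<dots> \<le> real (N div ?a) / L + D ^ 4"
      unfolding L_def using finP primeP D by (intro selberg_sieve) auto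
    also have "real (N div ?a) / L \<le> real N / real ?a * (1 / L)"
      using divide_right_mono[OF of_nat_div_le_of_nat[of N ?a, where ?'a = real], of L] L0 by simp
    also have "\<dots> \<le> real N / real ?a * (V / (1 - \<delta>))"
      by (intro mult_left_mono invL) auto
    also have "\<dots> = real N * (pmf (prime_model P) v / (1 - \<delta>))"
      using W0[OF v] by (subst pmf_prime_model) (auto simp: V_def)
    finally show ?thesis by simp
  qed
  \<comment> \<open>By unique factorisation distinct vectors in W have distinct products, and these
    are positive integers up to B.\<close>
  have cardW: "real (card W) \<le> B"
  proof -
    have "card W = card (prime_product P ` W)"
    proof (rule card_image[symmetric], rule inj_onI)
      fix v w assume vw: "v \<in> W" "w \<in> W" "prime_product P v = prime_product P w"
      have "exponents P (prime_product P u) = u" if "u \<in> W" for u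
        using W0[OF that] by (auto simp: exponents_prime_product)
      then show "v = w" using vw by metis
    qed
    also have "\<dots> \<le> card {1..nat \<lfloor>B\<rfloor>}"
    proof (rule card_mono)
      show "prime_product P ` W \<subseteq> {1..nat \<lfloor>B\<rfloor>}"
        using prime_product_pos by (auto simp: W_def S_def le_nat_floor Suc_le_eq)
    qed auto
    finally have "real (card W) \<le> real (nat \<lfloor>B\<rfloor>)" by simp
    then show ?thesis using B by linarith
  qed
  have "S \<subseteq> (\<Union>v\<in>W. {n\<in>{1..N}. exponents P n = v})"
    unfolding W_def S_def by auto
  then have "card S \<le> card (\<Union>v\<in>W. {n\<in>{1..N}. exponents P n = v})"
    by (intro card_mono) (use finS in auto)
  also have "\<dots> \<le> (\<Sum>v\<in>W. card {n\<in>{1..N}. exponents P n = v})"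
    by (rule card_UN_le) (rule finS)
  finally have "real (card S) \<le> (\<Sum>v\<in>W. real (card {n\<in>{1..N}. exponents P n = v}))"
    by (metis of_nat_le_iff of_nat_sum)
  also have "\<dots> \<le> (\<Sum>v\<in>W. real N * (pmf (prime_model P) v / (1 - \<delta>)) + D ^ 4)"
    by (intro sum_mono fibre)
  also have "\<dots> = real N * (measure_pmf.prob (prime_model P) W / (1 - \<delta>)) + real (card W) * D ^ 4"
    using finS by (simp add: sum.distrib measure_measure_pmf_finite sum_distrib_left sum_divide_distrib)
  also have "\<dots> \<le> real N * (measure_pmf.prob (prime_model P) A / (1 - \<delta>)) + B * D ^ 4"
    using \<delta> D cardW
    by (intro add_mono mult_left_mono divide_right_mono mult_right_mono measure_pmf.finite_measure_mono)
       (auto simp: W_def S_def)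
  finally have 1: "real (card S) \<le> \<dots>" .
  have "{n\<in>{1..N}. exponents P n \<in> A} \<subseteq> S \<union> {n\<in>{1..N}. real (prime_product P (exponents P n)) > B}"
    unfolding S_def by auto
  then have "card {n\<in>{1..N}. exponents P n \<in> A} \<le> card (S \<union> {n\<in>{1..N}. real (prime_product P (exponents P n)) > B})"
    by (intro card_mono) (use finS in auto)
  also have "\<dots> \<le> card S + card {n\<in>{1..N}. real (prime_product P (exponents P n)) > B}"
    by (rule card_Un_le)
  finally show ?thesis using 1 card_large_smooth_part[OF B, of N] by linarith
qed

end

text \<open>Because A is arbitrary, the complement of A yields the opposite inequality with the same
  error. Hence only an upper bound has to come from the sieve.\<close>

lemma empirical_le_model:
  assumes P: "P = {p. prime p \<and> real p \<le> y}" and y: "y \<ge> 1" and N: "N \<ge> 2"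
    and \<kappa>: "ln y \<le> \<kappa> * ln (real N)" "\<kappa> \<le> 1 / 64"
  shows "measure_pmf.prob (empirical_model P N) A
    \<le> measure_pmf.prob (prime_model P) A + 72 * \<kappa> + real N powr (-1/4)"
proof -
  have P': "P = {p. prime p \<and> p \<le> nat \<lfloor>y\<rfloor>}" using y by (auto simp: P le_nat_iff le_floor_iff)
  have finP: "finite P" unfolding P' by (rule finite_subset[of _ "{..nat \<lfloor>y\<rfloor>}"]) auto
  have pP: "\<And>p. p \<in> P \<Longrightarrow> prime p" by (simp add: P)
  have lnN: "ln (real N) > 0" using N by simp
  have "\<kappa> * ln (real N) \<ge> 0" using \<kappa>(1) ln_ge_zero[OF y] by linarith
  then have \<kappa>0: "\<kappa> \<ge> 0" using lnN by (simp add: zero_le_mult_iff)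
  define s where "s = (\<Sum>p\<in>P. ln (real p) / real p)"
  have "s \<le> 2 * ln (real (nat \<lfloor>y\<rfloor>))"
    unfolding P' s_def by (rule sum_ln_prime_over_prime_le) (use y in \<open>simp add: le_nat_floor\<close>)
  also have "\<dots> \<le> 2 * ln y" using y by simp
  finally have s: "s \<le> 2 * \<kappa> * ln (real N)" using \<kappa> by linarith
  \<comment> \<open>With \<open>B = real N powr (1/2)\<close> the total remainder B * D ^ 4 is N to
    the power 3/4. The bound \<open>s \<le> 2 * \<kappa> * ln (real N)\<close> becomes 32 * \<kappa>
    in terms of \<open>ln D\<close>, and \<open>\<kappa> \<le> 1 / 64\<close> keeps this at most
    1/2. The final 72 is 64 from the sieve plus 8 from the large smooth parts.\<close>
  define D where "D = real N powr (1/16)"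
  define B where "B = real N powr (1/2)"
  have D1: "D > 1" "B > 1" unfolding D_def B_def using N by (auto intro!: gr_one_powr)
  have lnD: "ln D = ln (real N) / 16" "ln B = ln (real N) / 2" unfolding D_def B_def using N by (auto simp: ln_powr)
  have D4: "D ^ 4 = real N powr (1/4)" unfolding D_def using N by (simp add: powr_power)
  have sD: "s \<le> 32 * \<kappa> * ln D" using s by (simp add: lnD)
  have card: "real (card {n\<in>{1..N}. exponents P n \<in> A})
    \<le> real N * (measure_pmf.prob (prime_model P) A / (1 - 32 * \<kappa>)) + B * D ^ 4 + real N * (2 * s / ln B)"
    unfolding s_def by (rule card_exponents_le_model)
      (use finP pP D1 sD \<kappa> in \<open>simp_all add: s_def\<close>)
  have "measure_pmf.prob (empirical_model P N) A = real (card {n\<in>{1..N}. exponents P n \<in> A}) / real N"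
    unfolding empirical_model_def using N by (simp add: measure_pmf_of_set vimage_def Int_def)
  also have "\<dots> \<le> (real N * (measure_pmf.prob (prime_model P) A / (1 - 32 * \<kappa>)) + B * D ^ 4 + real N * (2 * s / ln B)) / real N"
    by (rule divide_right_mono[OF card]) simp
  also have "\<dots> = measure_pmf.prob (prime_model P) A / (1 - 32 * \<kappa>) + B * D ^ 4 / real N + 2 * s / ln B"
    using N by (simp add: field_simps)
  also have "B * D ^ 4 / real N = real N powr (-1/4)"
  proof -
    have "B * D ^ 4 / real N = real N powr (1/2) * real N powr (1/4) / real N powr 1"
      using N by (simp add: B_def D4)
    also have "\<dots> = real N powr (1/2 + 1/4 - 1)" by (simp only: powr_add powr_diff)
    finally show ?thesis by simp
  qed
  also have "2 * s / ln B \<le> 8 * \<kappa>"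
    using s lnN by (simp add: lnD field_simps)
  also have "measure_pmf.prob (prime_model P) A / (1 - 32 * \<kappa>) \<le> measure_pmf.prob (prime_model P) A + 64 * \<kappa>"
  proof -
    define m where "m = measure_pmf.prob (prime_model P) A"
    have "m \<le> 1" "m \<ge> 0" by (auto simp: m_def)
    then have "\<kappa> * m \<le> \<kappa>" using \<kappa>0 by (simp add: mult_left_le)
    moreover have "\<kappa> * \<kappa> \<le> \<kappa> / 64" using \<kappa>0 \<kappa> mult_left_mono[of \<kappa> "1/64" \<kappa>] by simp
    ultimately have "m \<le> (m + 64 * \<kappa>) * (1 - 32 * \<kappa>)" by (simp add: algebra_simps)
    then show ?thesis using \<kappa> unfolding m_def[symmetric] by (simp add: field_simps)
  qed
  finally show ?thesis by simp
qed

text \<open>The parameter \<open>\<theta>\<close> covers two regimes of pair correlations: 1 for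
  events that are independent up to e, and 0 for events that practically never occur together. The
  diagonal is bounded by the single probabilities alone; there the terms with
  \<open>\<theta>\<close> and e are nonnegative and only enlarge the right side.\<close>

lemma second_moment_le:
  fixes \<mu> :: "'a pmf" and E :: "nat \<Rightarrow> 'a set" and c :: "nat \<Rightarrow> real"
  assumes Q: "finite Q" and e: "e \<ge> 0" and \<theta>: "\<theta> \<ge> 0"
    and single: "\<And>p. p \<in> Q \<Longrightarrow> measure_pmf.prob \<mu> (E p) \<le> 1 / real p"
    and pair: "\<And>p q. p \<in> Q \<Longrightarrow> q \<in> Q \<Longrightarrow> p \<noteq> q \<Longrightarrow>
      \<bar>measure_pmf.prob \<mu> (E p \<inter> E q) - \<theta> / (real p * real q)\<bar> \<le> e"
  shows "measure_pmf.expectation \<mu> (\<lambda>\<omega>. (\<Sum>p\<in>Q. c p * indicator (E p) \<omega>)\<^sup>2)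
    \<le> \<theta> * (\<Sum>p\<in>Q. c p / real p)\<^sup>2 + (\<Sum>p\<in>Q. (c p)\<^sup>2 / real p) + e * (\<Sum>p\<in>Q. \<bar>c p\<bar>)\<^sup>2"
proof -
  have "measure_pmf.expectation \<mu> (\<lambda>\<omega>. (\<Sum>p\<in>Q. c p * indicator (E p) \<omega>)\<^sup>2)
      = measure_pmf.expectation \<mu> (\<lambda>\<omega>. \<Sum>p\<in>Q. \<Sum>q\<in>Q. c p * c q * indicator (E p \<inter> E q) \<omega>)"
    by (simp add: power2_eq_square sum_product indicator_inter_arith mult_ac)
  also have "\<dots> = (\<Sum>p\<in>Q. \<Sum>q\<in>Q. c p * c q * measure_pmf.prob \<mu> (E p \<inter> E q))"
    by (simp add: Bochner_Integration.integral_sum measure_pmf.emeasure_eq_measure)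
  also have "\<dots> \<le> (\<Sum>p\<in>Q. \<Sum>q\<in>Q. \<theta> * (c p / real p * (c q / real q)) + (if p = q then (c q)\<^sup>2 / real q else 0)
                       + e * (\<bar>c p\<bar> * \<bar>c q\<bar>))"
  proof (intro sum_mono)
    fix p q assume pq: "p \<in> Q" "q \<in> Q"
    show "c p * c q * measure_pmf.prob \<mu> (E p \<inter> E q)
        \<le> \<theta> * (c p / real p * (c q / real q)) + (if p = q then (c q)\<^sup>2 / real q else 0) + e * (\<bar>c p\<bar> * \<bar>c q\<bar>)"
    proof (cases "p = q")
      case True
      have "c p * c p * measure_pmf.prob \<mu> (E p) \<le> c p * c p * (1 / real p)"
        by (intro mult_left_mono single pq) auto
      moreover have "0 \<le> \<theta> * (c p / real p * (c p / real p))" using \<theta> by (intro mult_nonneg_nonneg zero_le_square)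
      moreover have "0 \<le> e * (\<bar>c p\<bar> * \<bar>c p\<bar>)" using e by simp
      ultimately have "c p * c p * measure_pmf.prob \<mu> (E p)
          \<le> \<theta> * (c p / real p * (c p / real p)) + c p * c p * (1 / real p) + e * (\<bar>c p\<bar> * \<bar>c p\<bar>)"
        by linarith
      then show ?thesis using True by (simp add: power2_eq_square)
    next
      case False
      have "c p * c q * (measure_pmf.prob \<mu> (E p \<inter> E q) - \<theta> / (real p * real q))
          \<le> \<bar>c p * c q * (measure_pmf.prob \<mu> (E p \<inter> E q) - \<theta> / (real p * real q))\<bar>"
        by (rule abs_ge_self)
      also have "\<dots> = \<bar>c p\<bar> * \<bar>c q\<bar> * \<bar>measure_pmf.prob \<mu> (E p \<inter> E q) - \<theta> / (real p * real q)\<bar>"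
        by (simp add: abs_mult)
      also have "\<dots> \<le> \<bar>c p\<bar> * \<bar>c q\<bar> * e"
        by (intro mult_left_mono pair pq False) auto
      finally show ?thesis using False by (simp add: algebra_simps)
    qed
  qed
  also have "\<dots> = \<theta> * (\<Sum>p\<in>Q. c p / real p)\<^sup>2 + (\<Sum>p\<in>Q. (c p)\<^sup>2 / real p) + e * (\<Sum>p\<in>Q. \<bar>c p\<bar>)\<^sup>2"
    using Q by (simp only: sum.distrib power2_eq_square[of "sum _ _"] sum_product)
      (simp add: sum_distrib_left)
  finally show ?thesis .
qed

text \<open>The full sum coincides with the linear sum over primes with
  \<open>\<bar>f p\<bar> \<le> 1\<close> unless a prime with larger value occurs or some exponent is
  at least 2; exponent 0 contributes \<open>f 1 = 0\<close>. A union bound handles both exceptions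
  and Markov's inequality for the square does the rest. The measure is left general to serve random
  integers and the model alike.\<close>

lemma prob_truncated_sum_ge:
  fixes \<mu> :: "'a pmf" and v :: "'a \<Rightarrow> nat \<Rightarrow> nat" and f :: "nat \<Rightarrow> real"
  assumes Q: "finite Q" and f1: "f 1 = 0" and d: "d > 0"
    and one: "\<And>p. p \<in> Q \<Longrightarrow> measure_pmf.prob \<mu> {\<omega>. v \<omega> p \<ge> 1} \<le> 1 / real p"
    and two: "\<And>p. p \<in> Q \<Longrightarrow> measure_pmf.prob \<mu> {\<omega>. v \<omega> p \<ge> 2} \<le> 1 / (real p)\<^sup>2"
    and K: "measure_pmf.expectation \<mu>
      (\<lambda>\<omega>. (\<Sum>p\<in>{p\<in>Q. \<bar>f p\<bar> \<le> 1}. f p * indicator {\<omega>. v \<omega> p \<ge> 1} \<omega>)\<^sup>2) \<le> K"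
  shows "measure_pmf.prob \<mu> {\<omega>. \<bar>\<Sum>p\<in>Q. f (p ^ v \<omega> p)\<bar> \<ge> d}
    \<le> (\<Sum>p\<in>{p\<in>Q. \<bar>f p\<bar> > 1}. 1 / real p) + (\<Sum>p\<in>Q. 1 / (real p)\<^sup>2) + K / d\<^sup>2"
proof -
  define g where "g \<omega> = (\<Sum>p\<in>{p\<in>Q. \<bar>f p\<bar> \<le> 1}. f p * indicator {\<omega>. v \<omega> p \<ge> 1} \<omega>)" for \<omega>
  let ?big = "{p\<in>Q. \<bar>f p\<bar> > 1}"
  let ?A = "\<Union>p\<in>?big. {\<omega>. v \<omega> p \<ge> 1}" and ?B = "\<Union>p\<in>Q. {\<omega>. v \<omega> p \<ge> 2}"
    and ?C = "{\<omega>. (g \<omega>)\<^sup>2 \<ge> d\<^sup>2}"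
  have "{\<omega>. \<bar>\<Sum>p\<in>Q. f (p ^ v \<omega> p)\<bar> \<ge> d} \<subseteq> ?A \<union> ?B \<union> ?C"
  proof (rule subsetI)
    fix \<omega> assume \<omega>: "\<omega> \<in> {\<omega>. \<bar>\<Sum>p\<in>Q. f (p ^ v \<omega> p)\<bar> \<ge> d}"
    show "\<omega> \<in> ?A \<union> ?B \<union> ?C"
    proof (rule ccontr)
      assume n: "\<omega> \<notin> ?A \<union> ?B \<union> ?C"
      have "(\<Sum>p\<in>Q. f (p ^ v \<omega> p)) = g \<omega>"
        unfolding g_def
      proof (rule sum.mono_neutral_cong_right)
        show "\<forall>p\<in>Q - {p \<in> Q. \<bar>f p\<bar> \<le> 1}. f (p ^ v \<omega> p) = 0"
        proof
          fix p assume "p \<in> Q - {p \<in> Q. \<bar>f p\<bar> \<le> 1}"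
          then have "p \<in> ?big" by auto
          then have "\<not> v \<omega> p \<ge> 1" using n by blast
          then have "v \<omega> p = 0" by simp
          then show "f (p ^ v \<omega> p) = 0" using f1 by simp
        qed
        fix p assume "p \<in> {p \<in> Q. \<bar>f p\<bar> \<le> 1}"
        then have "\<not> v \<omega> p \<ge> 2" using n by auto
        then have "v \<omega> p = 0 \<or> v \<omega> p = 1" by linarith
        then show "f (p ^ v \<omega> p) = f p * indicator {\<omega>. 1 \<le> v \<omega> p} \<omega>"
          using f1 by auto
      qed (use Q in auto)
      then have "d \<le> \<bar>g \<omega>\<bar>" using \<omega> by simp
      then have "d\<^sup>2 \<le> (g \<omega>)\<^sup>2" using d by (simp add: abs_le_square_iff[symmetric])
      then show False using n by simp
    qed
  qed
  then have "measure_pmf.prob \<mu> {\<omega>. \<bar>\<Sum>p\<in>Q. f (p ^ v \<omega> p)\<bar> \<ge> d} \<le> measure_pmf.prob \<mu> (?A \<union> ?B \<union> ?C)"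
    by (intro measure_pmf.finite_measure_mono) auto
  also have "\<dots> \<le> measure_pmf.prob \<mu> ?A + measure_pmf.prob \<mu> ?B + measure_pmf.prob \<mu> ?C"
    using measure_Un_le[of ?A "measure_pmf \<mu>" ?B] measure_Un_le[of "?A \<union> ?B" "measure_pmf \<mu>" ?C]
    by simp
  also have "measure_pmf.prob \<mu> ?A \<le> (\<Sum>p\<in>?big. measure_pmf.prob \<mu> {\<omega>. v \<omega> p \<ge> 1})"
    using Q by (intro measure_pmf.finite_measure_subadditive_finite) auto
  also have "\<dots> \<le> (\<Sum>p\<in>?big. 1 / real p)"
    by (intro sum_mono one) auto
  also have "measure_pmf.prob \<mu> ?B \<le> (\<Sum>p\<in>Q. measure_pmf.prob \<mu> {\<omega>. v \<omega> p \<ge> 2})"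
    using Q by (intro measure_pmf.finite_measure_subadditive_finite) auto
  also have "\<dots> \<le> (\<Sum>p\<in>Q. 1 / (real p)\<^sup>2)"
    by (intro sum_mono two) auto
  also have "measure_pmf.prob \<mu> ?C \<le> K / d\<^sup>2"
  proof -
    have bnd: "\<bar>g \<omega>\<bar> \<le> (\<Sum>p\<in>{p\<in>Q. \<bar>f p\<bar> \<le> 1}. \<bar>f p\<bar>)" for \<omega>
      unfolding g_def by (rule order_trans[OF sum_abs]) (auto intro!: sum_mono simp: indicator_def)
    have "integrable (measure_pmf \<mu>) (\<lambda>\<omega>. (g \<omega>)\<^sup>2)"
    proof (rule measure_pmf.integrable_const_bound[where B = "(\<Sum>p\<in>{p\<in>Q. \<bar>f p\<bar> \<le> 1}. \<bar>f p\<bar>)\<^sup>2"])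
      show "AE \<omega> in measure_pmf \<mu>. norm ((g \<omega>)\<^sup>2) \<le> (\<Sum>p\<in>{p\<in>Q. \<bar>f p\<bar> \<le> 1}. \<bar>f p\<bar>)\<^sup>2"
        using bnd by (auto intro!: AE_I2 simp: power_mono[of "\<bar>g _\<bar>" _ 2, simplified])
    qed auto
    then have "measure_pmf.prob \<mu> {\<omega> \<in> space (measure_pmf \<mu>). d\<^sup>2 \<le> (g \<omega>)\<^sup>2}
        \<le> measure_pmf.expectation \<mu> (\<lambda>\<omega>. (g \<omega>)\<^sup>2) / d\<^sup>2"
      using d by (intro integral_Markov_inequality_measure[where A = "{}"]) auto
    also have "\<dots> \<le> K / d\<^sup>2"
      using K unfolding g_def by (intro divide_right_mono) auto
    finally show ?thesis by simp
  qed
  finally show ?thesis by simp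
qed

section \<open>Divisibility probabilities in the model and among the integers\<close>

lemma prob_geometric_atLeast:
  assumes "0 \<le> q" "q < 1"
  shows "measure_pmf.prob (geometric_pmf (1 - q)) {k..} = q ^ k"
proof -
  have "measure_pmf.prob (geometric_pmf (1 - q)) {k..} = 1 - measure_pmf.prob (geometric_pmf (1 - q)) {..<k}"
    by (subst measure_pmf.prob_compl[symmetric]) (auto intro!: arg_cong2[where f = measure])
  also have "measure_pmf.prob (geometric_pmf (1 - q)) {..<k} = (\<Sum>i<k. q ^ i * (1 - q))"
    using assms by (subst measure_measure_pmf_finite) (auto intro!: sum.cong pmf_geometric[THEN trans])
  also have "\<dots> = 1 - q ^ k"
    by (induction k) (auto simp: algebra_simps)
  finally show ?thesis by simp
qed

lemma prob_prime_model_ge: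
  assumes P: "finite P" "\<And>p. p \<in> P \<Longrightarrow> prime p" and S: "S \<subseteq> P"
  shows "measure_pmf.prob (prime_model P) {v. \<forall>p\<in>S. v p \<ge> k p} = (\<Prod>p\<in>S. (1 / real p) ^ k p)"
proof -
  have "{v. \<forall>p\<in>S. v p \<ge> k p} = Pi P (\<lambda>p. if p \<in> S then {k p..} else UNIV)"
    using S by (auto simp: Pi_def)
  then have "measure_pmf.prob (prime_model P) {v. \<forall>p\<in>S. v p \<ge> k p}
      = (\<Prod>p\<in>P. measure_pmf.prob (geometric_pmf (1 - 1 / real p)) (if p \<in> S then {k p..} else UNIV))"
    unfolding prime_model_def using P by (simp only: measure_Pi_pmf_Pi)
  also have "\<dots> = (\<Prod>p\<in>S. (1 / real p) ^ k p)"
  proof (rule prod.mono_neutral_cong_right)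
    fix p assume "p \<in> S"
    then have "prime p" using S P by auto
    then have "p > 1" by (rule prime_gt_1_nat)
    then show "measure_pmf.prob (geometric_pmf (1 - 1 / real p)) (if p \<in> S then {k p..} else UNIV) = (1 / real p) ^ k p"
      using \<open>p \<in> S\<close> prob_geometric_atLeast[of "1 / real p" "k p"] by simp
  qed (use P S in auto)
  finally show ?thesis .
qed

lemma prob_empirical_dvd:
  assumes "N > 0" "d > 0"
  shows "measure_pmf.prob (pmf_of_set {1..N}) {n. d dvd n} = real (N div d) / real N"
proof -
  have "{1..N} \<inter> {n. d dvd n} = {n\<in>{1..N}. d dvd n}" by auto
  then show ?thesis
    using assms card_multiples[of d N] by (simp add: measure_pmf_of_set)
qed

subsection \<open>Convergence of the model to the limit law\<close>

text \<open>The expectation over the geometric exponent is an absolutely convergent series,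
  dominated by the powers of 1 / p. Any conditional convergence is thus confined to the product over
  primes.\<close>

lemma char_geometric_law:
  assumes p: "prime p"
  shows "char (distr (measure_pmf (geometric_pmf (1 - 1 / real p))) borel (\<lambda>k. f (p ^ k))) \<tau>
    = of_real (1 - 1 / real p) * (\<Sum>\<nu>. cis (\<tau> * f (p ^ \<nu>)) / of_nat (p ^ \<nu>))"
proof -
  define q where "q = 1 / real p"
  have q: "0 < q" "q < 1" using prime_gt_1_nat[OF p] by (auto simp: q_def)
  have pmfq: "pmf (geometric_pmf (1 - q)) k = q ^ k * (1 - q)" for k
    using q by (subst pmf_geometric) auto
  have norm: "norm (pmf (geometric_pmf (1 - q)) k *\<^sub>R iexp (\<tau> * f (p ^ k))) = q ^ k * (1 - q)" for k
    using q by (simp add: pmfq)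
  have sm: "summable (\<lambda>k. norm (pmf (geometric_pmf (1 - q)) k *\<^sub>R iexp (\<tau> * f (p ^ k))))"
    unfolding norm using q by (intro summable_mult2 summable_geometric) auto
  have "char (distr (measure_pmf (geometric_pmf (1 - q))) borel (\<lambda>k. f (p ^ k))) \<tau>
      = (CLINT k|measure_pmf (geometric_pmf (1 - q)). iexp (\<tau> * f (p ^ k)))"
    unfolding char_def by (subst integral_distr) auto
  also have "\<dots> = (CLINT k|count_space UNIV. pmf (geometric_pmf (1 - q)) k *\<^sub>R iexp (\<tau> * f (p ^ k)))"
    unfolding measure_pmf_eq_density by (subst integral_density) auto
  also have "\<dots> = (\<Sum>k. pmf (geometric_pmf (1 - q)) k *\<^sub>R iexp (\<tau> * f (p ^ k)))"
    using sm by (intro integral_count_space_nat) (simp add: integrable_count_space_nat_iff)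
  also have "\<dots> = (\<Sum>k. of_real (1 - q) * (cis (\<tau> * f (p ^ k)) / of_nat (p ^ k)))"
  proof (rule suminf_cong)
    fix k
    have "of_real (q ^ k) = 1 / (of_nat (p ^ k) :: complex)"
      by (simp add: q_def power_divide)
    then have "cis (\<tau> * f (p ^ k)) / of_nat (p ^ k) = cis (\<tau> * f (p ^ k)) * of_real (q ^ k)"
      by (metis mult.right_neutral times_divide_eq_right)
    then show "pmf (geometric_pmf (1 - q)) k *\<^sub>R iexp (\<tau> * f (p ^ k)) = of_real (1 - q) * (cis (\<tau> * f (p ^ k)) / of_nat (p ^ k))"
      by (simp only: pmfq scaleR_conv_of_real cis_conv_exp of_real_mult mult_ac)
  qed
  also have "\<dots> = of_real (1 - q) * (\<Sum>k. cis (\<tau> * f (p ^ k)) / of_nat (p ^ k))"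
  proof (rule suminf_mult)
    have "norm (cis (\<tau> * f (p ^ k)) / of_nat (p ^ k)) = q ^ k" for k
      by (simp add: norm_divide norm_power q_def power_divide)
    then have "summable (\<lambda>k. norm (cis (\<tau> * f (p ^ k)) / of_nat (p ^ k)))"
      using q by (simp only:) (intro summable_geometric, simp)
    then show "summable (\<lambda>k. cis (\<tau> * f (p ^ k)) / of_nat (p ^ k))"
      by (rule summable_norm_cancel)
  qed
  finally show ?thesis unfolding q_def .
qed

definition model_law :: "(nat \<Rightarrow> real) \<Rightarrow> nat set \<Rightarrow> real measure" where
  "model_law f P = distr (measure_pmf (prime_model P)) borel (\<lambda>v. \<Sum>p\<in>P. f (p ^ v p))"

lemma real_distribution_model_law: "real_distribution (model_law f P)"
  unfolding model_law_def by (rule prob_space.real_distribution_distr[OF prob_space_measure_pmf]) simp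

lemma char_model_law:
  assumes P: "finite P" "\<And>p. p \<in> P \<Longrightarrow> prime p"
  shows "char (model_law f P) \<tau>
    = (\<Prod>p\<in>P. of_real (1 - 1 / real p) * (\<Sum>\<nu>. cis (\<tau> * f (p ^ \<nu>)) / of_nat (p ^ \<nu>)))"
proof -
  have "prob_space.indep_vars (measure_pmf (prime_model P)) (\<lambda>_. count_space UNIV) (\<lambda>p v. v p) P"
    unfolding prime_model_def by (rule indep_vars_Pi_pmf) (rule P)
  then have ind: "prob_space.indep_vars (measure_pmf (prime_model P)) (\<lambda>_. borel) (\<lambda>p v. f (p ^ v p)) P"
    by (rule prob_space.indep_vars_compose2[OF prob_space_measure_pmf,
          where X = "\<lambda>p v. v p" and Y = "\<lambda>p k. f (p ^ k)"]) simp
  have "char (model_law f P) \<tau>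
      = (\<Prod>p\<in>P. char (distr (measure_pmf (prime_model P)) borel (\<lambda>v. f (p ^ v p))) \<tau>)"
    unfolding model_law_def by (rule prob_space.char_distr_sum[OF prob_space_measure_pmf ind])
  also have "\<dots> = (\<Prod>p\<in>P. of_real (1 - 1 / real p) * (\<Sum>\<nu>. cis (\<tau> * f (p ^ \<nu>)) / of_nat (p ^ \<nu>)))"
  proof (rule prod.cong)
    fix p assume p: "p \<in> P"
    have "distr (measure_pmf (prime_model P)) borel (\<lambda>v. f (p ^ v p))
        = distr (distr (measure_pmf (prime_model P)) (count_space UNIV) (\<lambda>v. v p)) borel (\<lambda>k. f (p ^ k))"
      by (subst distr_distr) (auto simp: o_def)
    also have "distr (measure_pmf (prime_model P)) (count_space UNIV) (\<lambda>v. v p)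
        = measure_pmf (map_pmf (\<lambda>v. v p) (prime_model P))"
      by (simp add: map_pmf_rep_eq)
    also have "map_pmf (\<lambda>v. v p) (prime_model P) = geometric_pmf (1 - 1 / real p)"
      unfolding prime_model_def using P p by (subst Pi_pmf_component) auto
    finally show "char (distr (measure_pmf (prime_model P)) borel (\<lambda>v. f (p ^ v p))) \<tau>
        = of_real (1 - 1 / real p) * (\<Sum>\<nu>. cis (\<tau> * f (p ^ \<nu>)) / of_nat (p ^ \<nu>))"
      using char_geometric_law[OF P(2)[OF p]] by simp
  qed auto
  finally show ?thesis .
qed

text \<open>By independence, the partial products in the definition of the limit law are the
  characteristic functions of the finite models. They are taken in increasing order of the primes,
  so conditional convergence is enough for Levy's continuity theorem.\<close>

lemma model_law_tendsto:
  assumes "limit_law f M"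
  shows "weak_conv_m (\<lambda>n. model_law f {p. prime p \<and> p \<le> n}) M"
proof (rule levy_continuity)
  show "real_distribution M" using assms by (simp add: limit_law_def)
  show "real_distribution (model_law f {p. prime p \<and> p \<le> n})" for n
    by (rule real_distribution_model_law)
  fix \<tau> :: real
  define g where "g p = (if prime p
     then of_real (1 - 1 / real p) * (\<Sum>\<nu>. cis (\<tau> * f (p ^ \<nu>)) / of_nat (p ^ \<nu>)) else 1)" for p :: nat
  have "char (model_law f {p. prime p \<and> p \<le> n}) \<tau> = (\<Prod>p\<le>n. g p)" for n
  proof -
    have "char (model_law f {p. prime p \<and> p \<le> n}) \<tau> = (\<Prod>p | prime p \<and> p \<le> n. g p)"
      by (subst char_model_law) (auto simp: g_def)
    also have "\<dots> = (\<Prod>p\<le>n. g p)"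
      by (rule prod.mono_neutral_left) (auto simp: g_def)
    finally show ?thesis .
  qed
  moreover have "g has_prod char M \<tau>"
    using assms unfolding limit_law_def g_def by blast
  ultimately show "(\<lambda>n. char (model_law f {p. prime p \<and> p \<le> n}) \<tau>) \<longlonglongrightarrow> char M \<tau>"
    using has_prod_imp_tendsto[of g "char M \<tau>"] by simp
qed

text \<open>Weak convergence speaks only about continuity points of the limit, so thresholds are
  moved to one nearby. Being monotone, the distribution function has countably many jumps and cannot
  jump throughout an interval.\<close>

lemma isCont_cdf_between:
  assumes "real_distribution M" "a < b"
  obtains x where "a < x" "x < b" "isCont (cdf M) x"
proof -
  interpret real_distribution M by fact
  have "mono (cdf M)" by (auto intro!: monoI cdf_nondecreasing)
  then have "countable {x. \<not> isCont (cdf M) x}" by (rule mono_ctble_discont)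
  moreover have "uncountable {a<..<b}" using assms by (simp add: uncountable_open_interval)
  ultimately have "\<not> {a<..<b} \<subseteq> {x. \<not> isCont (cdf M) x}" using countable_subset by blast
  then show thesis using that by auto
qed

lemma cdf_model_law: "cdf (model_law f P) t = measure_pmf.prob (prime_model P) {v. (\<Sum>p\<in>P. f (p ^ v p)) \<le> t}"
  unfolding model_law_def cdf_def by (subst measure_distr) (auto intro!: arg_cong2[where f = measure])

lemma cdf_add_le_concentration:
  assumes "real_distribution M"
  shows "cdf M (y + l) \<le> cdf M y + concentration (cdf M) l"
proof -
  interpret real_distribution M by fact
  \<comment> \<open>A supremum of reals dominates its members only for a set that is bounded
    above.\<close>
  have "bdd_above (range (\<lambda>y. cdf M (y + l) - cdf M y))"
  proof (rule bdd_aboveI)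
    fix z assume "z \<in> range (\<lambda>y. cdf M (y + l) - cdf M y)"
    then obtain y where "z = cdf M (y + l) - cdf M y" by auto
    then show "z \<le> 1" using cdf_bounded_prob[of "y + l"] cdf_nonneg[of y] by linarith
  qed
  then have "cdf M (y + l) - cdf M y \<le> concentration (cdf M) l"
    unfolding concentration_def by (rule cSUP_upper[rotated]) simp
  then show ?thesis by linarith
qed

lemma concentration_nonneg:
  assumes "real_distribution M" "l \<ge> 0"
  shows "0 \<le> concentration (cdf M) l"
proof -
  interpret real_distribution M by fact
  show ?thesis
    using cdf_add_le_concentration[OF assms(1), of 0 l] cdf_nondecreasing[of 0 l] assms(2) by simp
qed

subsection \<open>Large primes\<close>

text \<open>Telescoping over all integers beyond m, the integer part of y, gives at most 1 / m. The
  factor 2 pays for replacing m by y, as y < m + 1 and m is at least 1.\<close>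

lemma sum_inverse_squares_le:
  assumes y: "y \<ge> 1" and Q: "finite Q" "\<And>p. p \<in> Q \<Longrightarrow> real p > y"
  shows "(\<Sum>p\<in>Q. 1 / (real p)\<^sup>2) \<le> 2 / y"
proof -
  define m where "m = nat \<lfloor>y\<rfloor>"
  have m: "m \<ge> 1" "real m \<le> y" "y < real m + 1"
    using y by (auto simp: m_def le_nat_iff)
  obtain k where k: "Q \<subseteq> {..k}" using Q(1) finite_nat_iff_bounded_le by auto
  have "Q \<subseteq> {m<..max m k}"
  proof
    fix p assume p: "p \<in> Q"
    then have "real m < real p" using Q(2) m by fastforce
    then show "p \<in> {m<..max m k}" using p k by auto
  qed
  then have "(\<Sum>p\<in>Q. 1 / (real p)\<^sup>2) \<le> (\<Sum>p\<in>{m<..max m k}. 1 / (real p)\<^sup>2)"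
    by (intro sum_mono2) auto
  also have "\<dots> \<le> 1 / real m - 1 / real (max m k)"
  proof (induction "max m k - m" arbitrary: k)
    case 0
    then have "max m k = m" by simp
    then show ?case by simp
  next
    case (Suc d)
    define j where "j = max m k - 1"
    have j: "max m k = Suc j" "j \<ge> m" "max m j = j" using Suc.hyps(2) by (auto simp: j_def)
    have IH: "(\<Sum>p\<in>{m<..j}. 1 / (real p)\<^sup>2) \<le> 1 / real m - 1 / real j"
      using Suc.hyps(1)[of j] Suc.hyps(2) j by simp
    have "{m<..Suc j} = insert (Suc j) {m<..j}" using j by auto
    then have "(\<Sum>p\<in>{m<..Suc j}. 1 / (real p)\<^sup>2) = 1 / (real (Suc j))\<^sup>2 + (\<Sum>p\<in>{m<..j}. 1 / (real p)\<^sup>2)"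
      by simp
    moreover have "1 / (real (Suc j))\<^sup>2 \<le> 1 / real j - 1 / real (Suc j)"
    proof -
      have "real j > 0" using j m by simp
      then show ?thesis by (simp add: divide_simps power2_eq_square)
    qed
    ultimately show ?case using IH j by simp
  qed
  also have "\<dots> \<le> 1 / real m" by simp
  also have "\<dots> \<le> 2 / y"
  proof -
    have "real m \<ge> 1" using m(1) by simp
    then have "y \<le> 2 * real m" using m(3) by linarith
    then show ?thesis using y \<open>real m \<ge> 1\<close> by (simp add: divide_simps)
  qed
  finally show ?thesis .
qed

text \<open>Exponents at least 2 make a geometric series of size at most twice the inverse square of
  the base, even if the base runs over all integers beyond 1. This complements the convergence
  assumption on f, which speaks about primes only, whereas the second tail in
  \<open>tail_majorant\<close> runs over prime powers.\<close>

lemma summable_primepow_nonprime: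
  "summable (\<lambda>q. if primepow q \<and> \<not> prime q then 1 / real q else 0)"
proof (rule summableI_nonneg_bounded)
  fix n
  have "(\<Sum>q<n. if primepow q \<and> \<not> prime q then 1 / real q else 0) = (\<Sum>q\<in>{q\<in>{..<n}. primepow q \<and> \<not> prime q}. 1 / real q)"
    by (intro sum.mono_neutral_cong_right) auto
  also have "\<dots> \<le> (\<Sum>q\<in>(\<lambda>(p, k). p ^ (k + 1)) ` ({1<..n} \<times> {1..n}). 1 / real q)"
  proof (rule sum_mono2)
    show "{q\<in>{..<n}. primepow q \<and> \<not> prime q} \<subseteq> (\<lambda>(p, k). p ^ (k + 1)) ` ({1<..n} \<times> {1..n})"
    proof
      fix q assume q: "q \<in> {q\<in>{..<n}. primepow q \<and> \<not> prime q}"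
      then obtain p k where pk: "prime p" "k > 0" "q = p ^ k" by (auto simp: primepow_def)
      then have "k \<noteq> 1" using q by auto
      have p2: "p \<ge> 2" using prime_ge_2_nat pk by auto
      have "k < 2 ^ k" by (rule less_exp)
      also have "\<dots> \<le> q" unfolding pk(3) using p2 by (intro power_mono) auto
      finally have "k < n" using q by simp
      moreover have "p \<le> q" unfolding pk(3) using pk p2 by (intro self_le_power) auto
      ultimately have "(p, k - 1) \<in> {1<..n} \<times> {1..n}" "q = p ^ (k - 1 + 1)"
        using q pk \<open>k \<noteq> 1\<close> p2 by auto
      then show "q \<in> (\<lambda>(p, k). p ^ (k + 1)) ` ({1<..n} \<times> {1..n})" by force
    qed
  qed auto
  also have "\<dots> \<le> (\<Sum>(p, k)\<in>{1<..n} \<times> {1..n}. 1 / real (p ^ (k + 1)))"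
    by (rule order_trans[OF sum_image_le]) (auto simp: o_def case_prod_unfold)
  also have "\<dots> = (\<Sum>p\<in>{1<..n}. \<Sum>k=1..n. 1 / real (p ^ (k + 1)))"
    by (simp add: sum.cartesian_product)
  also have "\<dots> \<le> (\<Sum>p\<in>{1<..n}. 2 * (1 / (real p)\<^sup>2))"
  proof (rule sum_mono)
    fix p assume "p \<in> {1<..n}"
    then have p: "real p \<ge> 2" by auto
    have "(\<Sum>k=1..n. 1 / real (p ^ (k + 1))) = 1 / real p * (\<Sum>k=1..n. (1 / real p) ^ k)"
      by (simp add: sum_distrib_left power_divide)
    also have "\<dots> \<le> 1 / real p * ((1 / real p) / (1 - 1 / real p))"
      using p by (intro mult_left_mono sum_power_le_geometric) auto
    also have "\<dots> \<le> 2 * (1 / (real p)\<^sup>2)"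
      using p by (simp add: field_simps power2_eq_square)
    finally show "(\<Sum>k=1..n. 1 / real (p ^ (k + 1))) \<le> 2 * (1 / (real p)\<^sup>2)" .
  qed
  also have "\<dots> \<le> 2 * (2 / 1)"
    unfolding sum_distrib_left[symmetric]
    by (intro mult_left_mono sum_inverse_squares_le) auto
  finally show "(\<Sum>q<n. if primepow q \<and> \<not> prime q then 1 / real q else 0) \<le> 4" by simp
qed auto

text \<open>Additivity forces \<open>f 1 = 0\<close>, so primes of P that do not divide n contribute
  nothing. One fixed P can therefore serve all n up to N.\<close>

lemma additive_function_eq_sum:
  assumes f: "additive_function f" and P: "finite P" "\<And>p. p \<in> P \<Longrightarrow> prime p"
    and n: "n > 0" "prime_factors n \<subseteq> P"
  shows "f n = (\<Sum>p\<in>P. f (p ^ multiplicity p n))"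
proof -
  have f1: "f 1 = 0" using f[unfolded additive_function_def, rule_format, of 1 1] by simp
  have "f (\<Prod>p\<in>Q. p ^ v p) = (\<Sum>p\<in>Q. f (p ^ v p))" if "finite Q" "Q \<subseteq> P" for Q and v :: "nat \<Rightarrow> nat"
    using that
  proof (induction Q rule: finite_induct)
    case (insert p Q)
    have "coprime p q" if "q \<in> Q" for q
      using insert P that by (intro primes_coprime) auto
    then have "coprime (p ^ v p) (\<Prod>q\<in>Q. q ^ v q)"
      by (intro prod_coprime_right) simp
    moreover have "p ^ v p > 0" "(\<Prod>q\<in>Q. q ^ v q) > 0"
      using insert P prime_gt_0_nat by (auto intro!: prod_pos)
    ultimately show ?case
      using insert f unfolding additive_function_def by simp
  qed (use f1 in simp)
  note * = this
  have "n = (\<Prod>p\<in>prime_factors n. p ^ multiplicity p n)"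
    by (rule prime_factorization_nat[OF n(1)])
  also have "\<dots> = (\<Prod>p\<in>P. p ^ multiplicity p n)"
  proof (rule prod.mono_neutral_left)
    show "\<forall>p\<in>P - prime_factors n. p ^ multiplicity p n = 1"
      using P n by (auto simp: prime_factors_dvd not_dvd_imp_multiplicity_0)
  qed (use n P in auto)
  finally have "f n = f (\<Prod>p\<in>P. p ^ multiplicity p n)" by simp
  then show ?thesis using *[of P] P by simp
qed

lemma multiplicity_ge_iff:
  assumes "prime (p::nat)" "n > 0"
  shows "multiplicity p n \<ge> k \<longleftrightarrow> p ^ k dvd n"
  using assms prime_ge_2_nat[OF assms(1)] by (subst power_dvd_iff_le_multiplicity) auto

lemma prob_pmf_of_set_cong:
  assumes "N > 0" "\<And>n. n \<in> {1..N} \<Longrightarrow> n \<in> A \<longleftrightarrow> n \<in> B"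
  shows "measure_pmf.prob (pmf_of_set {1..N::nat}) A = measure_pmf.prob (pmf_of_set {1..N}) B"
proof -
  have "{1..N} \<inter> A = {1..N} \<inter> B" using assms(2) by blast
  then show ?thesis using assms(1) by (simp add: measure_pmf_of_set)
qed

text \<open>Summability is kept next to the majorant because \<open>suminf\<close> of a divergent
  series carries no information: the inequalities in \<open>tail_majorant\<close> become usable only
  together with convergence.\<close>

locale additive_tail =
  fixes f :: "nat \<Rightarrow> real" and \<eta> :: "real \<Rightarrow> real"
  assumes additive: "additive_function f"
    and summable_min: "summable (\<lambda>p. if prime p then min 1 ((f p)\<^sup>2) / real p else 0)"
    and summable_small: "summable (\<lambda>p. if prime p \<and> \<bar>f p\<bar> \<le> 1 then f p / real p else 0)"
    and majorant: "tail_majorant f \<eta>"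
begin

lemma f1: "f 1 = 0"
  using additive[unfolded additive_function_def, rule_format, of 1 1] by simp

lemma eta_nonneg: "y \<ge> 1 \<Longrightarrow> \<eta> y \<ge> 0"
  using majorant by (simp add: tail_majorant_def)

lemma sum_min_le:
  assumes y: "y \<ge> 1" and Q: "finite Q" "\<And>p. p \<in> Q \<Longrightarrow> prime p \<and> real p > y"
  shows "(\<Sum>p\<in>Q. min 1 ((f p)\<^sup>2) / real p) \<le> \<eta> y"
proof -
  let ?g = "\<lambda>q. if primepow q \<and> real q > y then min 1 ((f q)\<^sup>2) / real q else 0"
  have "summable ?g"
  proof (rule summable_comparison_test)
    show "summable (\<lambda>q. (if prime q then min 1 ((f q)\<^sup>2) / real q else 0)
        + (if primepow q \<and> \<not> prime q then 1 / real q else 0))"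
      by (intro summable_add summable_min summable_primepow_nonprime)
    show "\<exists>N. \<forall>q\<ge>N. norm (?g q) \<le> (if prime q then min 1 ((f q)\<^sup>2) / real q else 0)
        + (if primepow q \<and> \<not> prime q then 1 / real q else 0)"
      by (auto intro!: exI[of _ 0] divide_right_mono)
  qed
  then have "(\<Sum>p\<in>Q. ?g p) \<le> suminf ?g"
    by (rule sum_le_suminf) (use Q in auto)
  also have "\<dots> \<le> \<eta> y" using majorant y by (simp add: tail_majorant_def)
  also have "(\<Sum>p\<in>Q. ?g p) = (\<Sum>p\<in>Q. min 1 ((f p)\<^sup>2) / real p)"
    using Q by (intro sum.cong) auto
  finally show ?thesis .
qed

text \<open>\<open>min 1\<close> of the square of f p is 1 when \<open>\<bar>f p\<bar> > 1\<close>
  and the square itself otherwise. One majorant thus pays for both the exceptional primes and the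
  variance.\<close>

lemma sum_big_le:
  assumes y: "y \<ge> 1" and Q: "finite Q" "\<And>p. p \<in> Q \<Longrightarrow> prime p \<and> real p > y"
  shows "(\<Sum>p\<in>{p\<in>Q. \<bar>f p\<bar> > 1}. 1 / real p) + (\<Sum>p\<in>{p\<in>Q. \<bar>f p\<bar> \<le> 1}. (f p)\<^sup>2 / real p) \<le> \<eta> y"
proof -
  have "(\<Sum>p\<in>{p\<in>Q. \<bar>f p\<bar> > 1}. 1 / real p) = (\<Sum>p\<in>{p\<in>Q. \<bar>f p\<bar> > 1}. min 1 ((f p)\<^sup>2) / real p)"
  proof (rule sum.cong)
    fix p assume "p \<in> {p \<in> Q. 1 < \<bar>f p\<bar>}"
    then have "1 < (f p)\<^sup>2" using one_less_power[of "\<bar>f p\<bar>" 2] by simp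
    then show "1 / real p = min 1 ((f p)\<^sup>2) / real p" by simp
  qed auto
  moreover have "(\<Sum>p\<in>{p\<in>Q. \<bar>f p\<bar> \<le> 1}. (f p)\<^sup>2 / real p) = (\<Sum>p\<in>{p\<in>Q. \<bar>f p\<bar> \<le> 1}. min 1 ((f p)\<^sup>2) / real p)"
  proof (rule sum.cong)
    fix p assume "p \<in> {p \<in> Q. \<bar>f p\<bar> \<le> 1}"
    then have "(f p)\<^sup>2 \<le> 1" by (simp add: abs_square_le_1)
    then show "(f p)\<^sup>2 / real p = min 1 ((f p)\<^sup>2) / real p" by simp
  qed auto
  moreover have "Q = {p\<in>Q. \<bar>f p\<bar> > 1} \<union> {p\<in>Q. \<bar>f p\<bar> \<le> 1}" by auto
  then have "(\<Sum>p\<in>Q. min 1 ((f p)\<^sup>2) / real p)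
     = (\<Sum>p\<in>{p\<in>Q. \<bar>f p\<bar> > 1}. min 1 ((f p)\<^sup>2) / real p) + (\<Sum>p\<in>{p\<in>Q. \<bar>f p\<bar> \<le> 1}. min 1 ((f p)\<^sup>2) / real p)"
    using Q by (subst sum.union_disjoint[symmetric]) auto
  ultimately show ?thesis using sum_min_le[OF assms] by simp
qed

text \<open>The terms have signs, so a block is not dominated by a tail containing it. It is the
  difference of the tails at y and z, each bounded by the majorant, and monotonicity replaces
  \<open>\<eta> z\<close> by \<open>\<eta> y\<close>.\<close>

lemma sum_small_le:
  assumes y: "1 \<le> y" "y \<le> z"
  shows "\<bar>\<Sum>p\<in>{p. prime p \<and> y < real p \<and> real p \<le> z \<and> \<bar>f p\<bar> \<le> 1}. f p / real p\<bar> \<le> 2 * \<eta> y"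
proof -
  define g where "g u p = (if prime p \<and> real p > u \<and> \<bar>f p\<bar> \<le> 1 then f p / real p else 0)" for u p
  have fin: "finite {p::nat. real p \<le> u}" for u
    by (rule finite_subset[of _ "{..nat \<lfloor>u\<rfloor>}"]) (auto simp: le_nat_floor)
  have sg: "summable (g u)" for u
  proof -
    have "eventually (\<lambda>p::nat. real p > u) sequentially"
      using filterlim_real_sequentially unfolding filterlim_at_top_dense by blast
    then have "eventually (\<lambda>p. g u p = (if prime p \<and> \<bar>f p\<bar> \<le> 1 then f p / real p else 0)) sequentially"
      by eventually_elim (auto simp: g_def)
    then show ?thesis using summable_small by (simp add: summable_cong)
  qed
  let ?S = "{p. prime p \<and> y < real p \<and> real p \<le> z \<and> \<bar>f p\<bar> \<le> 1}"
  have finS: "finite ?S" by (rule finite_subset[OF _ fin[of z]]) auto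
  have "(\<Sum>p\<in>?S. f p / real p) = (\<Sum>p\<in>?S. g y p - g z p)"
    by (intro sum.cong) (auto simp: g_def)
  also have "\<dots> = (\<Sum>p. g y p - g z p)"
    by (rule suminf_finite[symmetric, OF finS]) (use y in \<open>auto simp: g_def\<close>)
  also have "\<dots> = suminf (g y) - suminf (g z)"
    by (rule suminf_diff[symmetric, OF sg sg])
  finally have "\<bar>\<Sum>p\<in>?S. f p / real p\<bar> \<le> \<bar>suminf (g y)\<bar> + \<bar>suminf (g z)\<bar>" by linarith
  also have "\<bar>suminf (g y)\<bar> \<le> \<eta> y"
    using majorant y unfolding tail_majorant_def g_def by blast
  also have "\<bar>suminf (g z)\<bar> \<le> \<eta> z"
    using majorant order_trans[OF y] unfolding tail_majorant_def g_def by blast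
  also have "\<eta> z \<le> \<eta> y"
    using majorant y unfolding tail_majorant_def by (auto simp: monotone_on_def)
  finally show ?thesis by simp
qed

lemma primes_interval_finite: "finite {p. prime p \<and> y < real p \<and> real p \<le> z}"
  by (rule finite_subset[of _ "{..nat \<lfloor>z\<rfloor>}"]) (auto simp: le_nat_floor)

lemma primes_interval_small:
  "{p \<in> {p. prime p \<and> y < real p \<and> real p \<le> z}. \<bar>f p\<bar> \<le> 1}
    = {p. prime p \<and> y < real p \<and> real p \<le> z \<and> \<bar>f p\<bar> \<le> 1}"
  by auto

lemma primes_interval_small_finite:
  "finite {p. prime p \<and> y < real p \<and> real p \<le> z \<and> \<bar>f p\<bar> \<le> 1}"
  by (rule finite_subset[OF _ primes_interval_finite[of y z]]) auto

text \<open>Independent exponents give \<open>\<theta> = 1\<close> and no correlation error. What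
  matters is that z is absent from the bound: the cutoff of the model will tend to infinity while y
  stays fixed.\<close>

lemma model_tail:
  assumes y: "1 \<le> y" "y \<le> z" and d: "d > 0"
    and P: "finite P" "\<And>p. p \<in> P \<Longrightarrow> prime p" "{p. prime p \<and> y < real p \<and> real p \<le> z} \<subseteq> P"
  shows "measure_pmf.prob (prime_model P)
      {v. \<bar>\<Sum>p | prime p \<and> y < real p \<and> real p \<le> z. f (p ^ v p)\<bar> \<ge> d}
    \<le> \<eta> y + 2 / y + (4 * (\<eta> y)\<^sup>2 + \<eta> y) / d\<^sup>2"
proof -
  let ?Q = "{p. prime p \<and> y < real p \<and> real p \<le> z}"
  let ?Q1 = "{p \<in> ?Q. \<bar>f p\<bar> \<le> 1}"
  have one: "measure_pmf.prob (prime_model P) {v. v p \<ge> k} = (1 / real p) ^ k" if "p \<in> ?Q" for p k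
    using prob_prime_model_ge[OF P(1,2), of "{p}" "\<lambda>_. k"] that P(3) by auto
  have "measure_pmf.expectation (prime_model P) (\<lambda>v. (\<Sum>p\<in>?Q1. f p * indicator {v. v p \<ge> 1} v)\<^sup>2)
      \<le> 1 * (\<Sum>p\<in>?Q1. f p / real p)\<^sup>2 + (\<Sum>p\<in>?Q1. (f p)\<^sup>2 / real p) + 0 * (\<Sum>p\<in>?Q1. \<bar>f p\<bar>)\<^sup>2"
  proof (rule second_moment_le)
    fix p q assume pq: "p \<in> ?Q1" "q \<in> ?Q1" "p \<noteq> q"
    have "{v. v p \<ge> 1} \<inter> {v. v q \<ge> 1} = {v. \<forall>r\<in>{p, q}. v r \<ge> (1::nat)}" by auto
    then have "measure_pmf.prob (prime_model P) ({v. v p \<ge> 1} \<inter> {v. v q \<ge> 1}) = (\<Prod>r\<in>{p, q}. (1 / real r) ^ 1)"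
      using prob_prime_model_ge[OF P(1,2), of "{p, q}" "\<lambda>_. 1"] pq P(3) by auto
    then show "\<bar>measure_pmf.prob (prime_model P) ({v. v p \<ge> 1} \<inter> {v. v q \<ge> 1}) - 1 / (real p * real q)\<bar> \<le> 0"
      using pq by simp
  next
    fix p assume p: "p \<in> ?Q1"
    show "measure_pmf.prob (prime_model P) {v. v p \<ge> 1} \<le> 1 / real p"
      using one[of p 1] p by simp
  qed (use primes_interval_small_finite in auto)
  also have "(\<Sum>p\<in>?Q1. f p / real p)\<^sup>2 \<le> (2 * \<eta> y)\<^sup>2"
    unfolding primes_interval_small using sum_small_le[OF y] eta_nonneg[OF y(1)]
    by (intro power2_le_iff_abs_le[THEN iffD2]) auto
  finally have K: "measure_pmf.expectation (prime_model P) (\<lambda>v. (\<Sum>p\<in>?Q1. f p * indicator {v. v p \<ge> 1} v)\<^sup>2)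
      \<le> 4 * (\<eta> y)\<^sup>2 + (\<Sum>p\<in>?Q1. (f p)\<^sup>2 / real p)" by (simp add: power_mult_distrib)
  have big: "(\<Sum>p\<in>{p\<in>?Q. \<bar>f p\<bar> > 1}. 1 / real p) + (\<Sum>p\<in>?Q1. (f p)\<^sup>2 / real p) \<le> \<eta> y"
    by (rule sum_big_le) (use y primes_interval_finite in auto)
  have nn: "(\<Sum>p\<in>{p\<in>?Q. \<bar>f p\<bar> > 1}. 1 / real p) \<ge> 0" "(\<Sum>p\<in>?Q1. (f p)\<^sup>2 / real p) \<ge> 0"
    by (auto intro!: sum_nonneg)
  have "measure_pmf.prob (prime_model P) {v. \<bar>\<Sum>p\<in>?Q. f (p ^ v p)\<bar> \<ge> d}
    \<le> (\<Sum>p\<in>{p\<in>?Q. \<bar>f p\<bar> > 1}. 1 / real p) + (\<Sum>p\<in>?Q. 1 / (real p)\<^sup>2) + (4 * (\<eta> y)\<^sup>2 + \<eta> y) / d\<^sup>2"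
  proof (rule prob_truncated_sum_ge)
    fix p assume p: "p \<in> ?Q"
    show "measure_pmf.prob (prime_model P) {v. 1 \<le> v p} \<le> 1 / real p" using one[OF p, of 1] by simp
    show "measure_pmf.prob (prime_model P) {v. 2 \<le> v p} \<le> 1 / (real p)\<^sup>2"
      using one[OF p, of 2] by (simp add: power_divide)
  next
    show "measure_pmf.expectation (prime_model P) (\<lambda>v. (\<Sum>p\<in>?Q1. f p * indicator {v. v p \<ge> 1} v)\<^sup>2)
        \<le> 4 * (\<eta> y)\<^sup>2 + \<eta> y" using K big nn by linarith
  qed (use primes_interval_finite f1 d in auto)
  also have "(\<Sum>p\<in>?Q. 1 / (real p)\<^sup>2) \<le> 2 / y"
    by (rule sum_inverse_squares_le) (use y primes_interval_finite in auto)
  finally show ?thesis using big nn by linarith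
qed

lemma empirical_prime_power:
  assumes N: "N > 0" and p: "prime p"
  shows "measure_pmf.prob (pmf_of_set {1..N}) {n. multiplicity p n \<ge> k} \<le> 1 / real p ^ k"
proof -
  have p0: "p ^ k > 0" using prime_gt_0_nat[OF p] by simp
  have "measure_pmf.prob (pmf_of_set {1..N}) {n. multiplicity p n \<ge> k}
      = measure_pmf.prob (pmf_of_set {1..N}) {n. p ^ k dvd n}"
    by (rule prob_pmf_of_set_cong[OF N]) (use multiplicity_ge_iff[OF p] in auto)
  also have "\<dots> = real (N div p ^ k) / real N"
    by (rule prob_empirical_dvd[OF N p0])
  also have "\<dots> \<le> (real N / real (p ^ k)) / real N"
    by (intro divide_right_mono of_nat_div_le_of_nat) auto
  also have "\<dots> = 1 / real p ^ k" using N by simp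
  finally show ?thesis .
qed

lemma empirical_pair:
  assumes N: "N > 0" and pq: "prime p" "prime q" "p \<noteq> q"
  shows "measure_pmf.prob (pmf_of_set {1..N}) ({n. multiplicity p n \<ge> 1} \<inter> {n. multiplicity q n \<ge> 1})
    = real (N div (p * q)) / real N"
proof -
  have dvd: "p * q dvd n \<longleftrightarrow> p dvd n \<and> q dvd n" for n
    using pq by (auto intro: divides_mult primes_coprime dvd_mult_left dvd_mult_right)
  have "measure_pmf.prob (pmf_of_set {1..N}) ({n. multiplicity p n \<ge> 1} \<inter> {n. multiplicity q n \<ge> 1})
      = measure_pmf.prob (pmf_of_set {1..N}) {n. p * q dvd n}"
    unfolding dvd by (rule prob_pmf_of_set_cong[OF N])
      (use multiplicity_ge_iff[OF pq(1), of _ 1] multiplicity_ge_iff[OF pq(2), of _ 1] in auto)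
  then show ?thesis
    using prob_empirical_dvd[OF N, of "p * q"] pq by (simp add: prime_gt_0_nat)
qed

text \<open>The second moment K is left open, since primes below and above the square root of N need
  different estimates for it.\<close>

lemma empirical_tail_core:
  assumes y: "1 \<le> y" and d: "d > 0" and N: "N > 0"
    and Q: "finite Q" "\<And>p. p \<in> Q \<Longrightarrow> prime p \<and> real p > y"
    and K: "measure_pmf.expectation (pmf_of_set {1..N})
      (\<lambda>n. (\<Sum>p\<in>{p\<in>Q. \<bar>f p\<bar> \<le> 1}. f p * indicator {n. multiplicity p n \<ge> 1} n)\<^sup>2) \<le> K"
  shows "measure_pmf.prob (pmf_of_set {1..N}) {n. \<bar>\<Sum>p\<in>Q. f (p ^ multiplicity p n)\<bar> \<ge> d}
    \<le> \<eta> y + 2 / y + K / d\<^sup>2"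
proof -
  have "measure_pmf.prob (pmf_of_set {1..N}) {n. \<bar>\<Sum>p\<in>Q. f (p ^ multiplicity p n)\<bar> \<ge> d}
    \<le> (\<Sum>p\<in>{p\<in>Q. \<bar>f p\<bar> > 1}. 1 / real p) + (\<Sum>p\<in>Q. 1 / (real p)\<^sup>2) + K / d\<^sup>2"
  proof (rule prob_truncated_sum_ge[where v = "\<lambda>n p. multiplicity p n"])
    fix p assume p: "p \<in> Q"
    show "measure_pmf.prob (pmf_of_set {1..N}) {n. 1 \<le> multiplicity p n} \<le> 1 / real p"
      using empirical_prime_power[OF N, of p 1] Q(2)[OF p] by simp
    show "measure_pmf.prob (pmf_of_set {1..N}) {n. 2 \<le> multiplicity p n} \<le> 1 / (real p)\<^sup>2"
      using empirical_prime_power[OF N, of p 2] Q(2)[OF p] by simp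
  qed (use Q f1 d K in auto)
  moreover have "(\<Sum>p\<in>Q. 1 / (real p)\<^sup>2) \<le> 2 / y"
    by (rule sum_inverse_squares_le) (use y Q in auto)
  moreover have "(\<Sum>p\<in>{p\<in>Q. \<bar>f p\<bar> > 1}. 1 / real p) + (\<Sum>p\<in>{p\<in>Q. \<bar>f p\<bar> \<le> 1}. (f p)\<^sup>2 / real p) \<le> \<eta> y"
    by (rule sum_big_le[OF y Q])
  moreover have "(\<Sum>p\<in>{p\<in>Q. \<bar>f p\<bar> \<le> 1}. (f p)\<^sup>2 / real p) \<ge> 0"
    by (intro sum_nonneg) auto
  ultimately show ?thesis by linarith
qed

text \<open>Up to the square root of N, each pair of primes has correlation error at most 1 / N, and
  Cauchy-Schwarz makes the total at most \<open>\<eta> y\<close>. Beyond it two distinct primes have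
  a product exceeding N, so all mixed terms vanish and even the squared mean drops out.\<close>

lemma empirical_tail:
  assumes y: "1 \<le> y" "y \<le> sqrt (real N)" and d: "d > 0"
  shows "measure_pmf.prob (pmf_of_set {1..N})
      {n. \<bar>\<Sum>p | prime p \<and> y < real p \<and> real p \<le> real N. f (p ^ multiplicity p n)\<bar> \<ge> d}
    \<le> 2 * \<eta> y + 4 / y + (16 * (\<eta> y)\<^sup>2 + 12 * \<eta> y) / d\<^sup>2"
proof -
  define z where "z = sqrt (real N)"
  have z1: "z \<ge> 1" using y unfolding z_def by linarith
  have zz: "z * z = real N" by (simp add: z_def)
  have N: "N > 0" using zz z1 by (cases N) auto
  have zN: "z \<le> real N" using z1 zz mult_left_mono[of 1 z z] by simp
  define Qa where "Qa = {p. prime p \<and> y < real p \<and> real p \<le> z}"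
  define Qb where "Qb = {p. prime p \<and> z < real p \<and> real p \<le> real N}"
  let ?Q = "{p. prime p \<and> y < real p \<and> real p \<le> real N}"
  have fin: "finite Qa" "finite Qb" unfolding Qa_def Qb_def by (rule primes_interval_finite)+
  have Q: "?Q = Qa \<union> Qb" "Qa \<inter> Qb = {}" using y(2) zN unfolding Qa_def Qb_def z_def[symmetric] by auto
  have eta0: "\<eta> y \<ge> 0" using eta_nonneg y by simp
  let ?A = "{p\<in>Qa. \<bar>f p\<bar> \<le> 1}" and ?B = "{p\<in>Qb. \<bar>f p\<bar> \<le> 1}"
  have sq: "(\<Sum>p\<in>{p\<in>S. \<bar>f p\<bar> \<le> 1}. (f p)\<^sup>2 / real p) \<le> \<eta> y"
    if "finite S" "\<And>p. p \<in> S \<Longrightarrow> prime p \<and> real p > y" for S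
  proof -
    have "(\<Sum>p\<in>{p\<in>S. \<bar>f p\<bar> > 1}. 1 / real p) \<ge> 0" by (intro sum_nonneg) auto
    then show ?thesis using sum_big_le[OF y(1) that] by linarith
  qed
  have sqA: "(\<Sum>p\<in>?A. (f p)\<^sup>2 / real p) \<le> \<eta> y" and sqB: "(\<Sum>p\<in>?B. (f p)\<^sup>2 / real p) \<le> \<eta> y"
  proof -
    show "(\<Sum>p\<in>?A. (f p)\<^sup>2 / real p) \<le> \<eta> y"
      by (rule sq[OF fin(1)]) (simp add: Qa_def)
    show "(\<Sum>p\<in>?B. (f p)\<^sup>2 / real p) \<le> \<eta> y"
      by (rule sq[OF fin(2)]) (use y(2) in \<open>auto simp: Qb_def z_def\<close>)
  qed
  have KA: "measure_pmf.expectation (pmf_of_set {1..N}) (\<lambda>n. (\<Sum>p\<in>?A. f p * indicator {n. multiplicity p n \<ge> 1} n)\<^sup>2)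
      \<le> 4 * (\<eta> y)\<^sup>2 + 2 * \<eta> y"
  proof -
    have "measure_pmf.expectation (pmf_of_set {1..N}) (\<lambda>n. (\<Sum>p\<in>?A. f p * indicator {n. multiplicity p n \<ge> 1} n)\<^sup>2)
        \<le> 1 * (\<Sum>p\<in>?A. f p / real p)\<^sup>2 + (\<Sum>p\<in>?A. (f p)\<^sup>2 / real p) + (1 / real N) * (\<Sum>p\<in>?A. \<bar>f p\<bar>)\<^sup>2"
    proof (rule second_moment_le)
      fix p assume "p \<in> ?A"
      then show "measure_pmf.prob (pmf_of_set {1..N}) {n. multiplicity p n \<ge> 1} \<le> 1 / real p"
        using empirical_prime_power[OF N, of p 1] by (simp add: Qa_def)
    next
      fix p q assume pq: "p \<in> ?A" "q \<in> ?A" "p \<noteq> q"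
      have "real (N div (p * q)) / real N - 1 / (real p * real q)
          = (real (N div (p * q)) - real N / real (p * q)) / real N"
        using N by (simp add: field_simps)
      then have "\<bar>real (N div (p * q)) / real N - 1 / (real p * real q)\<bar>
          = \<bar>real (N div (p * q)) - real N / real (p * q)\<bar> / real N"
        by (simp only: abs_divide abs_of_nat)
      also have "\<dots> \<le> 1 / real N"
        by (intro divide_right_mono abs_real_div_diff_le) auto
      finally show "\<bar>measure_pmf.prob (pmf_of_set {1..N}) ({n. multiplicity p n \<ge> 1} \<inter> {n. multiplicity q n \<ge> 1}) - 1 / (real p * real q)\<bar> \<le> 1 / real N"
        using empirical_pair[OF N, of p q] pq by (simp add: Qa_def)
    qed (use fin in auto)
    also have "(\<Sum>p\<in>?A. f p / real p)\<^sup>2 \<le> (2 * \<eta> y)\<^sup>2"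
      unfolding Qa_def primes_interval_small using sum_small_le[of y z] y eta0
      by (intro power2_le_iff_abs_le[THEN iffD2]) (auto simp: z_def)
    also have "(1 / real N) * (\<Sum>p\<in>?A. \<bar>f p\<bar>)\<^sup>2 \<le> \<eta> y"
    proof -
      \<comment> \<open>The factor sqrt p is chosen to produce the variance sum. The other factor is
        a sum of p over at most z integers up to z, hence at most N: this fixes the splitting point
        z.\<close>
      have "(\<Sum>p\<in>?A. \<bar>f p\<bar>) = (\<Sum>p\<in>?A. sqrt (real p) * (\<bar>f p\<bar> / sqrt (real p)))"
        by (intro sum.cong) (auto simp: Qa_def prime_gt_0_nat)
      then have "(\<Sum>p\<in>?A. \<bar>f p\<bar>)\<^sup>2 \<le> (\<Sum>p\<in>?A. (sqrt (real p))\<^sup>2) * (\<Sum>p\<in>?A. (\<bar>f p\<bar> / sqrt (real p))\<^sup>2)"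
        by (simp only: Cauchy_Schwarz_ineq_sum)
      also have "\<dots> = (\<Sum>p\<in>?A. real p) * (\<Sum>p\<in>?A. (f p)\<^sup>2 / real p)"
        by (simp add: power_divide)
      also have "\<dots> \<le> real N * \<eta> y"
      proof (intro mult_mono sqA)
        have sub: "?A \<subseteq> {1..nat \<lfloor>z\<rfloor>}"
          by (auto simp: Qa_def le_nat_floor prime_ge_1_nat Suc_le_eq prime_gt_0_nat)
        have "(\<Sum>p\<in>?A. real p) \<le> (\<Sum>p\<in>?A. z)" by (intro sum_mono) (auto simp: Qa_def)
        also have "\<dots> = real (card ?A) * z" by simp
        also have "\<dots> \<le> z * z"
        proof (intro mult_right_mono)
          have "card ?A \<le> card {1..nat \<lfloor>z\<rfloor>}" by (intro card_mono sub) auto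
          then have "real (card ?A) \<le> real (nat \<lfloor>z\<rfloor>)" by simp
          then show "real (card ?A) \<le> z" using z1 by linarith
        qed (use z1 in auto)
        finally show "(\<Sum>p\<in>?A. real p) \<le> real N" by (simp add: zz)
      qed (auto intro!: sum_nonneg)
      finally show ?thesis using N by (simp add: field_simps)
    qed
    finally show ?thesis using sqA by (simp add: power_mult_distrib)
  qed
  have KB: "measure_pmf.expectation (pmf_of_set {1..N}) (\<lambda>n. (\<Sum>p\<in>?B. f p * indicator {n. multiplicity p n \<ge> 1} n)\<^sup>2)
      \<le> \<eta> y"
  proof -
    have "measure_pmf.expectation (pmf_of_set {1..N}) (\<lambda>n. (\<Sum>p\<in>?B. f p * indicator {n. multiplicity p n \<ge> 1} n)\<^sup>2)
        \<le> 0 * (\<Sum>p\<in>?B. f p / real p)\<^sup>2 + (\<Sum>p\<in>?B. (f p)\<^sup>2 / real p) + 0 * (\<Sum>p\<in>?B. \<bar>f p\<bar>)\<^sup>2"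
    proof (rule second_moment_le)
      fix p assume "p \<in> ?B"
      then show "measure_pmf.prob (pmf_of_set {1..N}) {n. multiplicity p n \<ge> 1} \<le> 1 / real p"
        using empirical_prime_power[OF N, of p 1] by (simp add: Qb_def)
    next
      fix p q assume pq: "p \<in> ?B" "q \<in> ?B" "p \<noteq> q"
      then have "z < real p" "z < real q" by (auto simp: Qb_def)
      then have "z * z < real p * real q" using z1 by (intro mult_strict_mono) auto
      then have "N < p * q" unfolding zz of_nat_mult[symmetric] of_nat_less_iff .
      then show "\<bar>measure_pmf.prob (pmf_of_set {1..N}) ({n. multiplicity p n \<ge> 1} \<inter> {n. multiplicity q n \<ge> 1}) - 0 / (real p * real q)\<bar> \<le> 0"
        using empirical_pair[OF N, of p q] pq by (simp add: Qb_def)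
    qed (use fin in auto)
    then show ?thesis using sqB by simp
  qed
  have tA: "measure_pmf.prob (pmf_of_set {1..N}) {n. \<bar>\<Sum>p\<in>Qa. f (p ^ multiplicity p n)\<bar> \<ge> d / 2}
      \<le> \<eta> y + 2 / y + (4 * (\<eta> y)\<^sup>2 + 2 * \<eta> y) / (d / 2)\<^sup>2"
    by (rule empirical_tail_core[OF y(1) _ N fin(1) _ KA]) (use d in \<open>auto simp: Qa_def\<close>)
  have tB: "measure_pmf.prob (pmf_of_set {1..N}) {n. \<bar>\<Sum>p\<in>Qb. f (p ^ multiplicity p n)\<bar> \<ge> d / 2}
      \<le> \<eta> y + 2 / y + \<eta> y / (d / 2)\<^sup>2"
    by (rule empirical_tail_core[OF y(1) _ N fin(2) _ KB]) (use d y in \<open>auto simp: Qb_def z_def\<close>)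
  have "{n. \<bar>\<Sum>p\<in>?Q. f (p ^ multiplicity p n)\<bar> \<ge> d}
     \<subseteq> {n. \<bar>\<Sum>p\<in>Qa. f (p ^ multiplicity p n)\<bar> \<ge> d / 2} \<union> {n. \<bar>\<Sum>p\<in>Qb. f (p ^ multiplicity p n)\<bar> \<ge> d / 2}"
    unfolding Q(1) sum.union_disjoint[OF fin Q(2)] by auto
  then have "measure_pmf.prob (pmf_of_set {1..N}) {n. \<bar>\<Sum>p\<in>?Q. f (p ^ multiplicity p n)\<bar> \<ge> d}
     \<le> measure_pmf.prob (pmf_of_set {1..N}) ({n. \<bar>\<Sum>p\<in>Qa. f (p ^ multiplicity p n)\<bar> \<ge> d / 2} \<union> {n. \<bar>\<Sum>p\<in>Qb. f (p ^ multiplicity p n)\<bar> \<ge> d / 2})"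
    by (intro measure_pmf.finite_measure_mono) auto
  also have "\<dots> \<le> measure_pmf.prob (pmf_of_set {1..N}) {n. \<bar>\<Sum>p\<in>Qa. f (p ^ multiplicity p n)\<bar> \<ge> d / 2}
      + measure_pmf.prob (pmf_of_set {1..N}) {n. \<bar>\<Sum>p\<in>Qb. f (p ^ multiplicity p n)\<bar> \<ge> d / 2}"
    by (rule measure_Un_le) auto
  also have "\<dots> \<le> (\<eta> y + 2 / y + (4 * (\<eta> y)\<^sup>2 + 2 * \<eta> y) / (d / 2)\<^sup>2) + (\<eta> y + 2 / y + \<eta> y / (d / 2)\<^sup>2)"
    by (intro add_mono tA tB)
  \<comment> \<open>Halving d multiplies the second moments by 4, and 12 is 8 from the lower range
    plus 4 from the upper one.\<close>
  also have "\<dots> = 2 * \<eta> y + 4 / y + (16 * (\<eta> y)\<^sup>2 + 12 * \<eta> y) / d\<^sup>2"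
    using d by (simp add: field_simps power2_eq_square)
  finally show ?thesis .
qed

end

subsection \<open>Comparison of the distribution functions\<close>

lemma prob_diff_le:
  assumes "\<And>\<omega>. \<omega> \<in> A \<Longrightarrow> \<omega> \<notin> C \<Longrightarrow> \<omega> \<in> B"
  shows "measure_pmf.prob \<mu> A \<le> measure_pmf.prob \<mu> B + measure_pmf.prob \<mu> C"
proof -
  have "measure_pmf.prob \<mu> A \<le> measure_pmf.prob \<mu> (B \<union> C)"
    using assms by (intro measure_pmf.finite_measure_mono) auto
  also have "\<dots> \<le> measure_pmf.prob \<mu> B + measure_pmf.prob \<mu> C"
    by (rule measure_Un_le) auto
  finally show ?thesis .
qed

context additive_tail
begin

text \<open>The set I grows by d when the large primes are dropped from the integers and by d again
  when they are added to the model; J has to absorb both. General I and J allow the same bound for a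
  half-line and for its complement.\<close>

lemma empirical_le_model_law:
  assumes y: "1 \<le> y" "y \<le> sqrt (real N)" "y \<le> real k" and N: "N \<ge> 2"
    and \<kappa>: "ln y \<le> \<kappa> * ln (real N)" "\<kappa> \<le> 1 / 64" and d: "d > 0"
    and J: "\<And>u w. u \<in> I \<Longrightarrow> \<bar>w - u\<bar> < 2 * d \<Longrightarrow> w \<in> J"
  shows "measure_pmf.prob (pmf_of_set {1..N}) {n. f n \<in> I}
    \<le> measure_pmf.prob (prime_model {p. prime p \<and> p \<le> k}) {v. (\<Sum>p | prime p \<and> p \<le> k. f (p ^ v p)) \<in> J}
      + (72 * \<kappa> + real N powr (-1/4) + 2 * (2 * \<eta> y + 4 / y + (16 * (\<eta> y)\<^sup>2 + 12 * \<eta> y) / d\<^sup>2))"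
proof -
  define \<tau> where "\<tau> = 2 * \<eta> y + 4 / y + (16 * (\<eta> y)\<^sup>2 + 12 * \<eta> y) / d\<^sup>2"
  define P where "P = {p. prime p \<and> real p \<le> y}"
  define Pk where "Pk = {p. prime p \<and> p \<le> k}"
  define Q where "Q z = {p. prime p \<and> y < real p \<and> real p \<le> z}" for z
  define X where "X v = (\<Sum>p\<in>P. f (p ^ v p))" for v
  define I' where "I' = {u. \<exists>w\<in>I. \<bar>u - w\<bar> < d}"
  have finP: "finite P" unfolding P_def
    by (rule finite_subset[of _ "{..nat \<lfloor>y\<rfloor>}"]) (auto simp: le_nat_floor)
  have finPk: "finite Pk" unfolding Pk_def by simp
  have finQ: "finite (Q z)" for z unfolding Q_def by (rule primes_interval_finite)
  have N0: "N > 0" using N by simp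
  have "sqrt (real N) \<le> real N"
    using N by (intro real_le_lsqrt) (simp_all add: power2_eq_square)
  then have yN: "y \<le> real N" using y by simp
  have split: "f n = X (\<lambda>p. multiplicity p n) + (\<Sum>p\<in>Q (real N). f (p ^ multiplicity p n))" if n: "n \<in> {1..N}" for n
  proof -
    have "f n = (\<Sum>p\<in>P \<union> Q (real N). f (p ^ multiplicity p n))"
    proof (rule additive_function_eq_sum[OF additive])
      show "prime_factors n \<subseteq> P \<union> Q (real N)"
      proof
        fix p assume "p \<in> prime_factors n"
        then have "prime p" "p \<le> n" using n by (auto simp: prime_factors_dvd intro: dvd_imp_le)
        then show "p \<in> P \<union> Q (real N)" using n by (auto simp: P_def Q_def)
      qed
    qed (use finP finQ n in \<open>auto simp: P_def Q_def\<close>)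
    also have "\<dots> = X (\<lambda>p. multiplicity p n) + (\<Sum>p\<in>Q (real N). f (p ^ multiplicity p n))"
      unfolding X_def using finP finQ by (subst sum.union_disjoint) (auto simp: P_def Q_def)
    finally show ?thesis .
  qed
  have "measure_pmf.prob (pmf_of_set {1..N}) {n. f n \<in> I}
      = measure_pmf.prob (pmf_of_set {1..N}) {n. X (\<lambda>p. multiplicity p n) + (\<Sum>p\<in>Q (real N). f (p ^ multiplicity p n)) \<in> I}"
    by (rule prob_pmf_of_set_cong[OF N0]) (simp add: split)
  also have "\<dots> \<le> measure_pmf.prob (pmf_of_set {1..N}) {n. X (\<lambda>p. multiplicity p n) \<in> I'}
      + measure_pmf.prob (pmf_of_set {1..N}) {n. \<bar>\<Sum>p\<in>Q (real N). f (p ^ multiplicity p n)\<bar> \<ge> d}"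
    by (rule prob_diff_le) (force simp: I'_def)
  also have "measure_pmf.prob (pmf_of_set {1..N}) {n. \<bar>\<Sum>p\<in>Q (real N). f (p ^ multiplicity p n)\<bar> \<ge> d} \<le> \<tau>"
    unfolding Q_def \<tau>_def by (rule empirical_tail) (use y d in auto)
  also have "measure_pmf.prob (pmf_of_set {1..N}) {n. X (\<lambda>p. multiplicity p n) \<in> I'}
      = measure_pmf.prob (empirical_model P N) {v. X v \<in> I'}"
    unfolding empirical_model_def measure_map_pmf
    by (simp add: vimage_def X_def exponents_def)
  also have "\<dots> \<le> measure_pmf.prob (prime_model P) {v. X v \<in> I'} + 72 * \<kappa> + real N powr (-1/4)"
    by (rule empirical_le_model[OF P_def y(1) N \<kappa>])
  \<comment> \<open>The sieve produces the model on primes up to y only. As a projection of the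
    model on primes up to k, it is moved to a common space where the remaining primes can be
    added.\<close>
  also have "prime_model P = map_pmf (\<lambda>v p. if p \<in> P then v p else 0) (prime_model Pk)"
    unfolding prime_model_def using finPk y(3) by (intro Pi_pmf_subset) (auto simp: P_def Pk_def)
  also have "measure_pmf.prob (map_pmf (\<lambda>v p. if p \<in> P then v p else 0) (prime_model Pk)) {v. X v \<in> I'}
      = measure_pmf.prob (prime_model Pk) {v. X v \<in> I'}"
    unfolding measure_map_pmf by (simp add: vimage_def X_def)
  also have "\<dots> \<le> measure_pmf.prob (prime_model Pk) {v. (\<Sum>p\<in>Pk. f (p ^ v p)) \<in> J}
      + measure_pmf.prob (prime_model Pk) {v. \<bar>\<Sum>p\<in>Q (real k). f (p ^ v p)\<bar> \<ge> d}"
  proof (rule prob_diff_le)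
    fix v assume v: "v \<in> {v. X v \<in> I'}" "v \<notin> {v. \<bar>\<Sum>p\<in>Q (real k). f (p ^ v p)\<bar> \<ge> d}"
    have "Pk = P \<union> Q (real k)" using y(3) by (auto simp: Pk_def P_def Q_def)
    then have "(\<Sum>p\<in>Pk. f (p ^ v p)) = X v + (\<Sum>p\<in>Q (real k). f (p ^ v p))"
      unfolding X_def using finP finQ by (simp add: sum.union_disjoint P_def Q_def disjoint_iff)
    moreover obtain u where "u \<in> I" "\<bar>X v - u\<bar> < d" using v by (auto simp: I'_def)
    ultimately show "v \<in> {v. (\<Sum>p\<in>Pk. f (p ^ v p)) \<in> J}"
      using v J[of u "\<Sum>p\<in>Pk. f (p ^ v p)"] by auto
  qed
  also have "measure_pmf.prob (prime_model Pk) {v. \<bar>\<Sum>p\<in>Q (real k). f (p ^ v p)\<bar> \<ge> d}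
      \<le> \<eta> y + 2 / y + (4 * (\<eta> y)\<^sup>2 + \<eta> y) / d\<^sup>2"
    unfolding Q_def by (rule model_tail) (use y d finPk in \<open>auto simp: Pk_def\<close>)
  also have "\<dots> \<le> \<tau>"
    unfolding \<tau>_def using eta_nonneg[OF y(1)] y d
    by (intro add_mono divide_right_mono) auto
  finally show ?thesis unfolding Pk_def \<tau>_def by simp
qed

text \<open>The one-sided comparison for \<open>{..t}\<close> and for \<open>{t<..}\<close> brackets
  the empirical value between model values at distance 2 * d, for every large k. Letting k tend to
  infinity at a continuity point between 2 * d and 3 * d away brings in M, and the total shift is
  paid for by three steps of length d.\<close>

lemma empirical_cdf_close:
  assumes lim: "limit_law f M" and y: "1 \<le> y" "y \<le> sqrt (real N)" and N: "N \<ge> 2"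
    and \<kappa>: "ln y \<le> \<kappa> * ln (real N)" "\<kappa> \<le> 1 / 64" and d: "d > 0"
  shows "\<bar>measure_pmf.prob (pmf_of_set {1..N}) {n. f n \<le> t} - cdf M t\<bar>
    \<le> 3 * concentration (cdf M) d
      + (72 * \<kappa> + real N powr (-1/4) + 2 * (2 * \<eta> y + 4 / y + (16 * (\<eta> y)\<^sup>2 + 12 * \<eta> y) / d\<^sup>2))"
proof -
  define err where "err = 72 * \<kappa> + real N powr (-1/4) + 2 * (2 * \<eta> y + 4 / y + (16 * (\<eta> y)\<^sup>2 + 12 * \<eta> y) / d\<^sup>2)"
  define em where "em = measure_pmf.prob (pmf_of_set {1..N}) {n. f n \<le> t}"
  define F where "F k = cdf (model_law f {p. prime p \<and> p \<le> k})" for k :: nat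
  have rd: "real_distribution M" using lim by (simp add: limit_law_def)
  interpret M: real_distribution M by (rule rd)
  have mono_F: "F k a \<le> F k b" if "a \<le> b" for k a b
  proof -
    interpret K: real_distribution "model_law f {p. prime p \<and> p \<le> k}"
      by (rule real_distribution_model_law)
    show ?thesis unfolding F_def using that by (rule K.cdf_nondecreasing)
  qed
  have conv: "(\<lambda>k. F k s) \<longlonglongrightarrow> cdf M s" if "isCont (cdf M) s" for s
    using model_law_tendsto[OF lim] that unfolding weak_conv_m_def weak_conv_def F_def by blast
  have ev: "eventually (\<lambda>k. y \<le> real k) sequentially"
    using filterlim_real_sequentially unfolding filterlim_at_top by blast
  have conc: "cdf M (a + 3 * d) \<le> cdf M a + 3 * concentration (cdf M) d" for a
    using cdf_add_le_concentration[OF rd, of a d] cdf_add_le_concentration[OF rd, of "a + d" d]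
      cdf_add_le_concentration[OF rd, of "a + 2 * d" d] by (simp add: algebra_simps)
  have up: "em \<le> F k (t + 2 * d) + err" if k: "y \<le> real k" for k
    using empirical_le_model_law[OF y k N \<kappa> d, of "{..t}" "{..t + 2 * d}"]
    by (auto simp: F_def cdf_model_law em_def err_def)
  have low: "F k (t - 2 * d) \<le> em + err" if k: "y \<le> real k" for k
  proof -
    have "measure_pmf.prob (pmf_of_set {1..N}) {n. f n \<in> {t<..}} = 1 - em"
      unfolding em_def by (subst measure_pmf.prob_compl[symmetric]) (auto intro!: arg_cong2[where f = measure])
    moreover have "measure_pmf.prob (prime_model {p. prime p \<and> p \<le> k})
        {v. (\<Sum>p | prime p \<and> p \<le> k. f (p ^ v p)) \<in> {t - 2 * d<..}} = 1 - F k (t - 2 * d)"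
      unfolding F_def cdf_model_law
      by (subst measure_pmf.prob_compl[symmetric]) (auto intro!: arg_cong2[where f = measure])
    moreover have "w \<in> {t - 2 * d<..}" if "u \<in> {t<..}" "\<bar>w - u\<bar> < 2 * d" for u w
      using that by (auto simp: abs_less_iff)
    then have "measure_pmf.prob (pmf_of_set {1..N}) {n. f n \<in> {t<..}}
        \<le> measure_pmf.prob (prime_model {p. prime p \<and> p \<le> k})
            {v. (\<Sum>p | prime p \<and> p \<le> k. f (p ^ v p)) \<in> {t - 2 * d<..}} + err"
      unfolding err_def by (rule empirical_le_model_law[OF y k N \<kappa> d])
    ultimately show ?thesis by linarith
  qed
  have "em \<le> cdf M t + 3 * concentration (cdf M) d + err"
  proof -
    obtain s where s: "t + 2 * d < s" "s < t + 3 * d" "isCont (cdf M) s"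
      by (rule isCont_cdf_between[OF rd, of "t + 2 * d" "t + 3 * d"]) (use d in auto)
    have "em - err \<le> cdf M s"
    proof (rule tendsto_lowerbound[OF conv[OF s(3)]])
      show "eventually (\<lambda>k. em - err \<le> F k s) sequentially"
        using ev
      proof eventually_elim
        case (elim k)
        then show ?case using up[of k] mono_F[of "t + 2 * d" s k] s(1) by linarith
      qed
    qed simp
    also have "\<dots> \<le> cdf M (t + 3 * d)" using s by (intro M.cdf_nondecreasing) auto
    finally show ?thesis using conc[of t] by linarith
  qed
  moreover have "cdf M t \<le> em + err + 3 * concentration (cdf M) d"
  proof -
    obtain s where s: "t - 3 * d < s" "s < t - 2 * d" "isCont (cdf M) s"
      by (rule isCont_cdf_between[OF rd, of "t - 3 * d" "t - 2 * d"]) (use d in auto)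
    have "cdf M s \<le> em + err"
    proof (rule tendsto_upperbound[OF conv[OF s(3)]])
      show "eventually (\<lambda>k. F k s \<le> em + err) sequentially"
        using ev
      proof eventually_elim
        case (elim k)
        then show ?case using low[of k] mono_F[of s "t - 2 * d" k] s(2) by linarith
      qed
    qed simp
    moreover have "cdf M (t - 3 * d) \<le> cdf M s" using s by (intro M.cdf_nondecreasing) auto
    ultimately show ?thesis using conc[of "t - 3 * d"] by simp
  qed
  ultimately show ?thesis unfolding em_def[symmetric] err_def[symmetric] by linarith
qed

end

section \<open>Choice of parameters and conclusion\<close>

lemma empirical_cdf_prob:
  assumes x: "x \<ge> 1"
  shows "\<bar>empirical_cdf f x t - measure_pmf.prob (pmf_of_set {1..nat \<lfloor>x\<rfloor>}) {n. f n \<le> t}\<bar> \<le> 1 / x"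
proof -
  define N where "N = nat \<lfloor>x\<rfloor>"
  have N: "real N \<le> x" "x < real N + 1" "N \<ge> 1"
    using x by (auto simp: N_def le_nat_iff)
  define m where "m = card ({1..N} \<inter> {n. f n \<le> t})"
  have "{n::nat. 1 \<le> n \<and> real n \<le> x \<and> f n \<le> t} = {1..N} \<inter> {n. f n \<le> t}"
    using x by (auto simp: N_def le_nat_iff le_floor_iff)
  then have e: "empirical_cdf f x t = real m / x" by (simp add: empirical_cdf_def m_def)
  have p: "measure_pmf.prob (pmf_of_set {1..N}) {n. f n \<le> t} = real m / real N"
    using N by (simp add: measure_pmf_of_set m_def)
  have "m \<le> N" unfolding m_def using card_mono[of "{1..N}" "{1..N} \<inter> {n. f n \<le> t}"] by simp
  \<comment> \<open>The two distribution functions count the same integers and differ only in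
    dividing by x or by its integer part, a relative change of at most 1 / x.\<close>
  then have r: "0 \<le> real m / real N" "real m / real N \<le> 1" using N by auto
  have "real m / real N - real m / x = real m / real N * ((x - real N) / x)"
    using N x by (simp add: field_simps)
  moreover have "0 \<le> real m / real N * ((x - real N) / x)" using r N x by (intro mult_nonneg_nonneg) auto
  moreover have "real m / real N * ((x - real N) / x) \<le> 1 * (1 / x)"
    using r N x by (intro mult_mono divide_right_mono) auto
  ultimately show ?thesis unfolding N_def[symmetric] e p by linarith
qed

lemma B_fun_ge_1: "B_fun f v \<ge> 1"
proof -
  have "0 \<le> (\<Sum>q | primepow q \<and> real q \<le> v. (f q)\<^sup>2 / real q)" by (intro sum_nonneg) auto
  then have "sqrt 1 \<le> B_fun f v" unfolding B_fun_def by (intro real_sqrt_le_mono) linarith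
  then show ?thesis by simp
qed

lemma (in additive_tail) empirical_cdf_error:
  assumes lim: "limit_law f M" and eps: "admissible_eps \<eta> \<epsilon>" and x: "x \<ge> 3"
    and small: "\<epsilon> x \<le> 1 / 128" and T: "T \<ge> 3" and C0: "C0 > 0"
    and eta: "T\<^sup>2 * \<eta> (x powr \<epsilon> x) \<le> C0 * \<epsilon> x powr (1/3)"
  shows "\<bar>empirical_cdf f x t - cdf M t\<bar>
    \<le> 3 * concentration (cdf M) (1 / T) + 154 * \<epsilon> x + (28 * C0 + 32 * C0\<^sup>2) * \<epsilon> x powr (1/3)"
proof -
  define e where "e = \<epsilon> x"
  define y where "y = x powr e"
  define N where "N = nat \<lfloor>x\<rfloor>"
  have lnx: "ln x > 0" using x by simp
  have "1 / sqrt (ln x) < e" using eps x by (auto simp: admissible_eps_def e_def)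
  then have e0: "e > 0" "1 < e * sqrt (ln x)"
    using lnx by (auto simp: field_simps intro: less_trans[of 0 "1 / sqrt (ln x)"])
  have e1: "e \<le> 1 / 128" using small by (simp add: e_def)
  have "1 < (e * sqrt (ln x))\<^sup>2" using e0 by (intro one_less_power) auto
  \<comment> \<open>The right side is \<open>ln y\<close>, so y exceeds 1 / e. This is how the lower
    bound imposed on \<open>\<epsilon> x\<close> enters.\<close>
  then have elnx: "1 / e < e * ln x" using e0 lnx by (simp add: power_mult_distrib field_simps power2_eq_square)
  have lny: "ln y = e * ln x" using x by (simp add: y_def ln_powr)
  have y0: "y > 0" using x by (simp add: y_def)
  have "1 / e \<le> y"
    using ln_le_minus_one[OF y0] elnx lny by linarith
  then have y: "1 / y \<le> e" using e0 y0 by (simp add: field_simps)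
  have y1: "1 \<le> y" using x e0 by (simp add: y_def ge_one_powr_ge_zero)
  have N: "real N \<le> x" "x < real N + 1" "N \<ge> 3"
    using x by (auto simp: N_def le_nat_iff le_floor_iff)
  have "3 * real N \<le> real N * real N" using N by simp
  then have xN: "x \<le> (real N)\<^sup>2" using N unfolding power2_eq_square by linarith
  then have lnN: "ln x \<le> 2 * ln (real N)"
    using x N ln_le_cancel_iff[of x "(real N)\<^sup>2"] by (simp add: ln_realpow)
  \<comment> \<open>The fourth power serves twice: it yields the bound of y by the square root of N
    required for the large primes, and it bounds \<open>real N powr (-1/4)\<close> by 1 / y.\<close>
  have yN: "y powr 4 \<le> real N"
  proof -
    have "y powr 4 = x powr (4 * e)" using x by (simp add: y_def powr_powr mult.commute)
    also have "\<dots> \<le> x powr (1/2)" using x e1 by (intro powr_mono) auto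
    also have "\<dots> \<le> ((real N)\<^sup>2) powr (1/2)" using x xN by (intro powr_mono2) auto
    also have "\<dots> = real N" using N by (simp add: powr_half_sqrt)
    finally show ?thesis .
  qed
  have y4: "y powr 4 = y ^ 4" using y0 by (simp add: powr_realpow)
  have ysq: "y \<le> sqrt (real N)"
  proof (rule real_le_rsqrt)
    have "y ^ 2 \<le> y ^ 4" using y1 by (intro power_increasing) auto
    then show "y\<^sup>2 \<le> real N" using yN y4 by linarith
  qed
  have N4: "real N powr (-1/4) \<le> e"
  proof -
    have "real N powr (-1/4) \<le> (y powr 4) powr (-1/4)"
      using yN y0 by (intro powr_mono2') auto
    also have "\<dots> = y powr (4 * (-1/4))" by (rule powr_powr)
    also have "\<dots> = 1 / y" using y0 by (simp add: powr_minus_divide)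
    finally show ?thesis using y by linarith
  qed
  have "y \<le> x powr 1" unfolding y_def using x e1 by (intro powr_mono) auto
  then have "1 / x \<le> 1 / y" using x y0 by (intro divide_left_mono) auto
  then have xinv: "1 / x \<le> e" using y by linarith
  define h where "h = \<eta> y"
  have h0: "h \<ge> 0" unfolding h_def by (rule eta_nonneg[OF y1])
  define w where "w = e powr (1/3)"
  have w: "0 \<le> w" "w \<le> 1" unfolding w_def using e0 e1 by (auto intro: powr_le1)
  have T2h: "T\<^sup>2 * h \<le> C0 * w" using eta by (simp add: h_def y_def e_def w_def)
  have "1 \<le> T\<^sup>2" using T by simp
  then have hT: "h \<le> T\<^sup>2 * h" using h0 mult_right_mono[of 1 "T\<^sup>2" h] by simp
  then have h: "h \<le> C0 * w" using T2h by linarith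
  have "C0 * w \<le> C0" using w C0 by (simp add: mult_left_le)
  then have hC: "h \<le> C0" using h by linarith
  \<comment> \<open>One factor h is combined with the square of T and is small by hypothesis; a
    further factor h is only bounded by C0, whence the square of C0 in the result.\<close>
  have "(16 * h\<^sup>2 + 12 * h) / (1 / T)\<^sup>2 = (16 * h + 12) * (T\<^sup>2 * h)"
    using T by (simp add: field_simps power2_eq_square)
  also have "\<dots> \<le> (16 * C0 + 12) * (C0 * w)"
    by (rule mult_mono) (use hC T2h h0 C0 in auto)
  finally have quad: "(16 * h\<^sup>2 + 12 * h) / (1 / T)\<^sup>2 \<le> (16 * C0 + 12) * (C0 * w)" .
  have total: "2 * (2 * h + 4 / y + (16 * C0 + 12) * (C0 * w)) \<le> 8 * e + (28 * C0 + 32 * C0\<^sup>2) * w"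
    using h y by (simp add: algebra_simps power2_eq_square)
  have combine: "c \<le> 3 * Qc + 154 * e + z"
    if "c \<le> 3 * Qc + (72 * (2 * e) + v + 2 * (2 * h + s + a)) + u" "u \<le> e" "v \<le> e" "a \<le> b"
      "2 * (2 * h + s + b) \<le> 8 * e + z"
    for a b c s u v z Qc
  proof -
    have "2 * (2 * h + s + a) \<le> 2 * (2 * h + s + b)" using that by simp
    then show ?thesis using that by linarith
  qed
  \<comment> \<open>Here \<open>\<kappa>\<close> is 2 * e, because
    \<open>ln x \<le> 2 * ln (real N)\<close>. The constant 154 collects 144 from
    \<open>72 * \<kappa>\<close>, 8 from twice 4 / y, and 1 each from
    \<open>real N powr (-1/4)\<close> and 1 / x.\<close>
  have "\<bar>measure_pmf.prob (pmf_of_set {1..N}) {n. f n \<le> t} - cdf M t\<bar>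
    \<le> 3 * concentration (cdf M) (1 / T)
      + (72 * (2 * e) + real N powr (-1/4) + 2 * (2 * \<eta> y + 4 / y + (16 * (\<eta> y)\<^sup>2 + 12 * \<eta> y) / (1 / T)\<^sup>2))"
  proof (rule empirical_cdf_close[OF lim y1 ysq])
    show "ln y \<le> 2 * e * ln (real N)"
      unfolding lny using mult_left_mono[OF lnN, of e] e0 by simp
  qed (use N e1 T in auto)
  moreover have "\<bar>empirical_cdf f x t - measure_pmf.prob (pmf_of_set {1..N}) {n. f n \<le> t}\<bar> \<le> 1 / x"
    unfolding N_def by (rule empirical_cdf_prob) (use x in auto)
  ultimately have "\<bar>empirical_cdf f x t - cdf M t\<bar> \<le> 3 * concentration (cdf M) (1 / T)
      + (72 * (2 * e) + real N powr (-1/4) + 2 * (2 * h + 4 / y + (16 * h\<^sup>2 + 12 * h) / (1 / T)\<^sup>2)) + 1 / x"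
    unfolding h_def by linarith
  from combine[OF this xinv N4 quad total] show ?thesis unfolding e_def w_def .
qed

theorem theorem1p2:
  fixes C0 :: real
  assumes "C0 > 0"
  shows "\<exists>C::real. \<forall>(f :: nat \<Rightarrow> real) (\<eta> :: real \<Rightarrow> real) (\<epsilon> :: real \<Rightarrow> real) (M :: real measure).
    additive_function f \<longrightarrow>
    summable (\<lambda>p. if prime p then min 1 ((f p)\<^sup>2) / real p else 0) \<longrightarrow>
    summable (\<lambda>p. if prime p \<and> \<bar>f p\<bar> \<le> 1 then f p / real p else 0) \<longrightarrow>
    \<not> summable (\<lambda>p. if prime p \<and> f p \<noteq> 0 then 1 / real p else 0) \<longrightarrow>
    tail_majorant f \<eta> \<longrightarrow> admissible_eps \<eta> \<epsilon> \<longrightarrow> limit_law f M \<longrightarrow>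
    (\<forall>(R::real) (T::real) (x::real). R \<ge> 3 \<longrightarrow> T \<ge> 3 \<longrightarrow> x \<ge> 3 \<longrightarrow>
      2 * ln (ln R) + 1/2 * T\<^sup>2 * \<eta> R + 7 \<le> 1/4 * ln (1 / \<epsilon> x) \<longrightarrow>
      T\<^sup>2 * \<eta> (x powr \<epsilon> x) \<le> C0 * \<epsilon> x powr (1/3) \<longrightarrow>
      (SUP y. \<bar>empirical_cdf f x y - cdf M y\<bar>)
        \<le> C * (concentration (cdf M) (1 / T)
               + \<epsilon> x powr (1/6) * ln (T * B_fun f R / \<epsilon> x) + \<eta> R))"
proof (intro exI allI impI)
  fix f \<eta> \<epsilon> M and R T x :: real
  assume f: "additive_function f" "summable (\<lambda>p. if prime p then min 1 ((f p)\<^sup>2) / real p else 0)"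
    "summable (\<lambda>p. if prime p \<and> \<bar>f p\<bar> \<le> 1 then f p / real p else 0)" "tail_majorant f \<eta>"
    and eps: "admissible_eps \<eta> \<epsilon>" and lim: "limit_law f M"
    and R: "R \<ge> 3" and T: "T \<ge> 3" and x: "x \<ge> 3"
    and cond: "2 * ln (ln R) + 1/2 * T\<^sup>2 * \<eta> R + 7 \<le> 1/4 * ln (1 / \<epsilon> x)"
    and eta: "T\<^sup>2 * \<eta> (x powr \<epsilon> x) \<le> C0 * \<epsilon> x powr (1/3)"
  interpret additive_tail f \<eta> by unfold_locales (use f in auto)
  define e where "e = \<epsilon> x"
  have "1 / sqrt (ln x) < e" using eps x by (auto simp: admissible_eps_def e_def)
  moreover have "1 / sqrt (ln x) \<ge> 0" using x by simp
  ultimately have e0: "e > 0" by linarith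
  have ln3: "1 \<le> ln u" if "u \<ge> 3" for u :: real
    using that exp_le by (subst ln_ge_iff) auto
  have etaR: "\<eta> R \<ge> 0" using eta_nonneg R by simp
  then have "0 \<le> 1/2 * T\<^sup>2 * \<eta> R" by simp
  \<comment> \<open>The other two terms are nonnegative, as \<open>ln R\<close> is at least 1, so
    the summand 7 alone gives 28. Only e at most 1 / 128 is extracted from this, which is exactly
    \<open>\<kappa> \<le> 1 / 64\<close> for \<open>\<kappa> = 2 * e\<close>.\<close>
  then have "28 \<le> ln (1 / e)" using cond ln_ge_zero[OF ln3[OF R]] unfolding e_def by linarith
  then have "exp 28 \<le> 1 / e" using e0 by (subst (asm) ln_ge_iff) auto
  moreover have "128 \<le> exp (28 :: real)" using exp_lower_Taylor_quadratic[of "28 :: real"] by simp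
  ultimately have "128 \<le> 1 / e" by linarith
  then have e1: "e \<le> 1 / 128" using e0 by (simp add: field_simps)
  define Qc where "Qc = concentration (cdf M) (1 / T)"
  define lg where "lg = ln (T * B_fun f R / e)"
  have Q0: "Qc \<ge> 0"
    unfolding Qc_def using lim T by (intro concentration_nonneg) (auto simp: limit_law_def)
  have "3 * 1 \<le> T * B_fun f R" using T B_fun_ge_1[of f R] by (intro mult_mono) auto
  also have "\<dots> \<le> T * B_fun f R / e"
    using T B_fun_ge_1[of f R] e0 e1 by (simp add: field_simps mult_left_le)
  finally have lg: "lg \<ge> 1" unfolding lg_def by (intro ln3) simp
  \<comment> \<open>The sum of the two error coefficients, also large enough to replace the 3 before
    the concentration. It mentions only C0, as required of a constant chosen before f.\<close>
  define K where "K = 154 + 28 * C0 + 32 * C0\<^sup>2"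
  have K: "K \<ge> 3" using assms by (simp add: K_def)
  have ep: "e \<le> e powr (1/6)" "e powr (1/3) \<le> e powr (1/6)"
    using powr_mono'[of "1/6" 1 e] powr_mono'[of "1/6" "1/3" e] e0 e1 by auto
  have "e powr (1/6) * 1 \<le> e powr (1/6) * lg" using lg by (intro mult_left_mono) auto
  \<comment> \<open>Both error terms enter the claimed one: e is below 1, so the smaller exponent
    gives the larger power, and the logarithm is at least 1 because its argument is at least
    T.\<close>
  then have el: "e \<le> e powr (1/6) * lg" "e powr (1/3) \<le> e powr (1/6) * lg" using ep by linarith+
  show "(SUP y. \<bar>empirical_cdf f x y - cdf M y\<bar>)
        \<le> K * (concentration (cdf M) (1 / T) + \<epsilon> x powr (1/6) * ln (T * B_fun f R / \<epsilon> x) + \<eta> R)"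
  proof (rule cSUP_least)
    fix t
    have "\<bar>empirical_cdf f x t - cdf M t\<bar> \<le> 3 * Qc + 154 * e + (28 * C0 + 32 * C0\<^sup>2) * e powr (1/3)"
      unfolding Qc_def e_def using e1 by (intro empirical_cdf_error[OF lim eps x _ T assms eta]) (simp add: e_def)
    also have "\<dots> \<le> K * Qc + 154 * (e powr (1/6) * lg) + (28 * C0 + 32 * C0\<^sup>2) * (e powr (1/6) * lg)"
      using K Q0 el assms by (intro add_mono mult_left_mono mult_right_mono) auto
    also have "\<dots> = K * (Qc + e powr (1/6) * lg)" by (simp add: K_def algebra_simps)
    also have "\<dots> \<le> K * (Qc + e powr (1/6) * lg + \<eta> R)"
      using K etaR by (intro mult_left_mono) auto
    finally show "\<bar>empirical_cdf f x t - cdf M t\<bar>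
        \<le> K * (concentration (cdf M) (1 / T) + \<epsilon> x powr (1/6) * ln (T * B_fun f R / \<epsilon> x) + \<eta> R)"
      unfolding Qc_def lg_def e_def .
  qed simp
qed

end
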